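(* Let $G$ be a ribbon graph and $v$ a vertex of $G$. (1) Let $e_1, e_2$ be edges incident to $v$ and let $\beta_1 = \beta_{(v,e_1)}$, $\beta_2 = \beta_{(v,e_2)}$ be the corresponding Bernardi bijections $S(G) \to B(G)$. Then there exists $\gamma_0 \in \operatorname{Pic}^0(G)$ such that $\beta_2(T) = \gamma_0 \cdot \beta_1(T)$ for all $T \in S(G)$. (2) The action $\operatorname{Pic}^0(G) \times S(G) \to S(G)$ defined by $\gamma \cdot T := \beta_{(v,e)}^{-1}\left(\gamma \cdot \beta_{(v,e)}(T)\right)$, for an edge $e$ incident to $v$, depends only on $v$ and not on the choice of $e$.
   Context: A graph means a finite connected multigraph without loop edges; a ribbon graph is a graph with a cyclic ordering of the edges around each vertex. $S(G)$ is the set of spanning trees. Divisors are formal integer combinations of vertices; $\operatorname{Div}^d(G)$ those of degree $d$. For $f : V(G) \to \mathbb{Z}$, $\Delta f = \sum_{u} \big(\sum_{\text{edges } uw} (f(u)-f(w))\big)(u)$; principal divisors are those of the form $\Delta f$; $D \sim D'$ if $D - D'$ is principal. $\operatorname{Pic}^d(G)$ is the set of linear equivalence classes of degree-$d$ divisors; $\operatorname{Pic}^0(G)$ is a group acting on $\operatorname{Pic}^d(G)$ by addition. The genus is $g = |E(G)|-|V(G)|+1$. For a spanning tree $T$ with non-tree edges $e_1,\dots,e_g$, a $T$-break divisor is $\sum_i (v_i)$ with $v_i$ an endpoint of $e_i$; a break divisor is a $T$-break divisor for some $T$; $B(G)$ is the set of break divisors. Every class in $\operatorname{Pic}^g(G)$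 contains exactly one break divisor, so $\operatorname{Pic}^0(G)$ acts simply transitively on $B(G)$ by $\gamma \cdot D :=$ the unique break divisor linearly equivalent to $D + \gamma$. Bernardi map: for a vertex $v$, an edge $e$ incident to $v$, and a spanning tree $T$, the tour starts at $v$ and examines edges at $v$ in cyclic order starting with $e$; at a current vertex $u$, an examined edge $f \notin T$ is "cut through" from $u$ and the next edge at $u$ is examined, while an examined edge $f \in T$ is walked along to its other endpoint $u'$, after which the edges at $u'$ are examined in cyclic order starting with the edge after $f$. The tour ends when each tree edge has been traversed in both directions. For $f \notin T$, $\eta_{(v,e)}(f)$ is the endpoint from which $f$ is first cut through, and $\beta_{(v,e)}(T) = \sum_{f \notin T} (\eta_{(v,e)}(f)) \in B(G)$. The map $\beta_{(v,e)} : S(G) \to B(G)$ is a bijection. *)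

theory Defs
  imports Main
begin

section \<open>Multigraphs (no loops) with a ribbon structure\<close>

text \<open>A graph is given by a vertex set V, an edge set E (edges are abstract objects,
so parallel edges are allowed) and a map ends giving the two endpoints of each edge.
A ribbon structure is given by rot u, a cyclic permutation of the edges incident to u:
rot u f is the edge following f in the cyclic order at u.\<close>

definition incident :: "('e \<Rightarrow> 'v \<times> 'v) \<Rightarrow> 'e \<Rightarrow> 'v \<Rightarrow> bool" where
  "incident ends f u \<longleftrightarrow> u = fst (ends f) \<or> u = snd (ends f)"

definition inc_edges :: "'e set \<Rightarrow> ('e \<Rightarrow> 'v \<times> 'v) \<Rightarrow> 'v \<Rightarrow> 'e set" where
  "inc_edges E ends u = {f \<in> E. incident ends f u}"

definition other_end :: "('e \<Rightarrow> 'v \<times> 'v) \<Rightarrow> 'e \<Rightarrow> 'v \<Rightarrow> 'v" where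
  "other_end ends f u = (if u = fst (ends f) then snd (ends f) else fst (ends f))"

definition adj_rel :: "('e \<Rightarrow> 'v \<times> 'v) \<Rightarrow> 'e set \<Rightarrow> ('v \<times> 'v) set" where
  "adj_rel ends F = {(x, y). \<exists>f\<in>F. (x, y) = ends f \<or> (y, x) = ends f}"

definition connected_on :: "'v set \<Rightarrow> ('e \<Rightarrow> 'v \<times> 'v) \<Rightarrow> 'e set \<Rightarrow> bool" where
  "connected_on V ends F \<longleftrightarrow> (\<forall>x\<in>V. \<forall>y\<in>V. (x, y) \<in> (adj_rel ends F)\<^sup>*)"

definition graph :: "'v set \<Rightarrow> 'e set \<Rightarrow> ('e \<Rightarrow> 'v \<times> 'v) \<Rightarrow> bool" where
  "graph V E ends \<longleftrightarrow> finite V \<and> finite E \<and> V \<noteq> {} \<and>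
     (\<forall>f\<in>E. fst (ends f) \<in> V \<and> snd (ends f) \<in> V \<and> fst (ends f) \<noteq> snd (ends f)) \<and>
     connected_on V ends E"

definition ribbon_graph :: "'v set \<Rightarrow> 'e set \<Rightarrow> ('e \<Rightarrow> 'v \<times> 'v) \<Rightarrow> ('v \<Rightarrow> 'e \<Rightarrow> 'e) \<Rightarrow> bool" where
  "ribbon_graph V E ends rot \<longleftrightarrow> graph V E ends \<and>
     (\<forall>u\<in>V. bij_betw (rot u) (inc_edges E ends u) (inc_edges E ends u) \<and>
            (\<forall>f\<in>inc_edges E ends u. \<forall>g\<in>inc_edges E ends u. \<exists>n. (rot u ^^ n) f = g))"

section \<open>Spanning trees\<close>

text \<open>A spanning tree: a connected spanning subgraph without cycles (no edge of T has its
endpoints joined in T with that edge removed).\<close>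

definition spanning_trees :: "'v set \<Rightarrow> 'e set \<Rightarrow> ('e \<Rightarrow> 'v \<times> 'v) \<Rightarrow> 'e set set" where
  "spanning_trees V E ends = {T. T \<subseteq> E \<and> connected_on V ends T \<and>
     (\<forall>f\<in>T. (fst (ends f), snd (ends f)) \<notin> (adj_rel ends (T - {f}))\<^sup>*)}"

section \<open>Divisors, linear equivalence, Picard group, break divisors\<close>

type_synonym 'v divisor = "'v \<Rightarrow> int"

definition is_divisor :: "'v set \<Rightarrow> 'v divisor \<Rightarrow> bool" where
  "is_divisor V D \<longleftrightarrow> (\<forall>u. u \<notin> V \<longrightarrow> D u = 0)"

definition deg :: "'v set \<Rightarrow> 'v divisor \<Rightarrow> int" where
  "deg V D = (\<Sum>u\<in>V. D u)"

definition laplacian :: "'e set \<Rightarrow> ('e \<Rightarrow> 'v \<times> 'v) \<Rightarrow> ('v \<Rightarrow> int) \<Rightarrow> 'v divisor" where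
  "laplacian E ends f = (\<lambda>u. \<Sum>g\<in>inc_edges E ends u. f u - f (other_end ends g u))"

definition lin_equiv :: "'e set \<Rightarrow> ('e \<Rightarrow> 'v \<times> 'v) \<Rightarrow> 'v divisor \<Rightarrow> 'v divisor \<Rightarrow> bool" where
  "lin_equiv E ends D D' \<longleftrightarrow> (\<exists>f. (\<lambda>u. D u - D' u) = laplacian E ends f)"

text \<open>Pic^0: linear equivalence classes of degree-0 divisors.\<close>

definition Pic0 :: "'v set \<Rightarrow> 'e set \<Rightarrow> ('e \<Rightarrow> 'v \<times> 'v) \<Rightarrow> 'v divisor set set" where
  "Pic0 V E ends = {{D'. is_divisor V D' \<and> lin_equiv E ends D D'} | D.
       is_divisor V D \<and> deg V D = 0}"

definition break_divisors :: "'v set \<Rightarrow> 'e set \<Rightarrow> ('e \<Rightarrow> 'v \<times> 'v) \<Rightarrow> 'v divisor set" where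
  "break_divisors V E ends = {D. \<exists>T\<in>spanning_trees V E ends. \<exists>c.
       (\<forall>f\<in>E - T. incident ends f (c f)) \<and>
       D = (\<lambda>u. int (card {f \<in> E - T. c f = u}))}"

text \<open>Action of Pic^0 on break divisors: gamma . D is the unique break divisor
linearly equivalent to D + gamma.\<close>

definition pic_act :: "'v set \<Rightarrow> 'e set \<Rightarrow> ('e \<Rightarrow> 'v \<times> 'v) \<Rightarrow> 'v divisor set \<Rightarrow> 'v divisor \<Rightarrow> 'v divisor" where
  "pic_act V E ends \<gamma> D = (THE B. B \<in> break_divisors V E ends \<and>
       (\<exists>\<delta>\<in>\<gamma>. lin_equiv E ends B (\<lambda>u. D u + \<delta> u)))"

section \<open>The Bernardi tour and the Bernardi map\<close>

text \<open>A state of the tour is (current vertex u, currently examined edge f at u).\<close>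

definition tour_step :: "('e \<Rightarrow> 'v \<times> 'v) \<Rightarrow> ('v \<Rightarrow> 'e \<Rightarrow> 'e) \<Rightarrow> 'e set \<Rightarrow> 'v \<times> 'e \<Rightarrow> 'v \<times> 'e" where
  "tour_step ends rot T st = (let u = fst st; f = snd st in
     if f \<in> T then (let u' = other_end ends f u in (u', rot u' f))
     else (u, rot u f))"

definition tour :: "('e \<Rightarrow> 'v \<times> 'v) \<Rightarrow> ('v \<Rightarrow> 'e \<Rightarrow> 'e) \<Rightarrow> 'v \<Rightarrow> 'e \<Rightarrow> 'e set \<Rightarrow> nat \<Rightarrow> 'v \<times> 'e" where
  "tour ends rot v e T n = (tour_step ends rot T ^^ n) (v, e)"

text \<open>eta f: the endpoint from which the non-tree edge f is first cut through.\<close>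

definition bernardi_eta :: "('e \<Rightarrow> 'v \<times> 'v) \<Rightarrow> ('v \<Rightarrow> 'e \<Rightarrow> 'e) \<Rightarrow> 'v \<Rightarrow> 'e \<Rightarrow> 'e set \<Rightarrow> 'e \<Rightarrow> 'v" where
  "bernardi_eta ends rot v e T f =
     fst (tour ends rot v e T (LEAST n. snd (tour ends rot v e T n) = f))"

definition bernardi :: "'e set \<Rightarrow> ('e \<Rightarrow> 'v \<times> 'v) \<Rightarrow> ('v \<Rightarrow> 'e \<Rightarrow> 'e) \<Rightarrow> 'v \<Rightarrow> 'e \<Rightarrow> 'e set \<Rightarrow> 'v divisor" where
  "bernardi E ends rot v e T =
     (\<lambda>u. int (card {f \<in> E - T. bernardi_eta ends rot v e T f = u}))"

text \<open>Induced action of Pic^0 on spanning trees via beta_(v,e).\<close>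

definition tree_act :: "'v set \<Rightarrow> 'e set \<Rightarrow> ('e \<Rightarrow> 'v \<times> 'v) \<Rightarrow> ('v \<Rightarrow> 'e \<Rightarrow> 'e) \<Rightarrow> 'v \<Rightarrow> 'e
      \<Rightarrow> 'v divisor set \<Rightarrow> 'e set \<Rightarrow> 'e set" where
  "tree_act V E ends rot v e \<gamma> T =
     inv_into (spanning_trees V E ends) (bernardi E ends rot v e)
       (pic_act V E ends \<gamma> (bernardi E ends rot v e T))"

end

theory Submission
  imports Defs
begin

text \<open>The key fact is that a tree edge \<open>h\<close> splits the vertices into two sides, and the tour visits the
side away from its start in one block, between the two traversals of \<open>h\<close>.

Hence starting with the edge after \<open>e\<close> instead of \<open>e\<close> changes the Bernardi divisor, up to the
Laplacian of the indicator function of a side of \<open>e\<close>, by moving one chip from \<open>v\<close> across \<open>e\<close>,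
whatever the tree. Since the Bernardi map is onto the break divisors, this also shows that break
divisors can be translated by any divisor of degree 0: such divisors are sums of chip moves across
edges. Together with uniqueness of the break divisor in a class (a maximum principle) and the
bijectivity of the Bernardi map this gives both claims.

Injectivity: at the first edge where the tours of two trees differ, count the chips beyond that
edge. Surjectivity: among the pairs of a tree and an assignment of chips to endpoints that represent
a break divisor, the one that cuts as early as possible along its tour is the Bernardi one; otherwise
a tree edge can be exchanged for the first edge whose chip lies at the wrong end.\<close>

section \<open>Trees and cuts\<close>

lemma adj_rel_sym: "(x, y) \<in> adj_rel ends F \<Longrightarrow> (y, x) \<in> adj_rel ends F"
  by (auto simp: adj_rel_def)

lemma adj_rtrancl_sym:
  assumes "(x, y) \<in> (adj_rel ends F)\<^sup>*"
  shows "(y, x) \<in> (adj_rel ends F)\<^sup>*"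
proof -
  have "sym ((adj_rel ends F)\<^sup>*)"
    by (rule sym_rtrancl) (auto simp: sym_def intro: adj_rel_sym)
  then show ?thesis using assms by (auto dest: symD)
qed

lemma adj_rtrancl_mono:
  assumes "F \<subseteq> F'" "(x, y) \<in> (adj_rel ends F)\<^sup>*"
  shows "(x, y) \<in> (adj_rel ends F')\<^sup>*"
proof -
  have "adj_rel ends F \<subseteq> adj_rel ends F'" using assms(1) by (auto simp: adj_rel_def)
  from rtrancl_mono[OF this] assms(2) show ?thesis by blast
qed

lemma adj_edge: "f \<in> F \<Longrightarrow> (fst (ends f), snd (ends f)) \<in> (adj_rel ends F)\<^sup>*"
  by (rule r_into_rtrancl) (force simp: adj_rel_def)

definition crosses :: "('e \<Rightarrow> 'v \<times> 'v) \<Rightarrow> 'v set \<Rightarrow> 'e \<Rightarrow> bool" where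
  "crosses ends S f \<longleftrightarrow> (fst (ends f) \<in> S) \<noteq> (snd (ends f) \<in> S)"

definition inside :: "('e \<Rightarrow> 'v \<times> 'v) \<Rightarrow> 'e set \<Rightarrow> 'v set \<Rightarrow> 'e set" where
  "inside ends F S = {f \<in> F. fst (ends f) \<in> S \<and> snd (ends f) \<in> S}"

definition comp_of :: "('e \<Rightarrow> 'v \<times> 'v) \<Rightarrow> 'e set \<Rightarrow> 'v \<Rightarrow> 'v set" where
  "comp_of ends F x = {y. (x, y) \<in> (adj_rel ends F)\<^sup>*}"

text \<open>The acyclicity clause of \<open>spanning_trees\<close>, for an arbitrary edge set, so
  that it passes to the pieces in the induction on forests.\<close>

definition acyclic_edges :: "('e \<Rightarrow> 'v \<times> 'v) \<Rightarrow> 'e set \<Rightarrow> bool" where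
  "acyclic_edges ends F \<longleftrightarrow>
     (\<forall>f\<in>F. (fst (ends f), snd (ends f)) \<notin> (adj_rel ends (F - {f}))\<^sup>*)"

lemma acyclic_edges_mono: "acyclic_edges ends F \<Longrightarrow> G \<subseteq> F \<Longrightarrow> acyclic_edges ends G"
  unfolding acyclic_edges_def
  by (meson Diff_mono adj_rtrancl_mono in_mono subset_refl)

lemma crossing_edge_exists:
  assumes "(x, y) \<in> (adj_rel ends F)\<^sup>*" "x \<in> S" "y \<notin> S"
  shows "\<exists>f\<in>F. crosses ends S f"
  using assms
proof (induction rule: rtrancl_induct)
  case (step y z)
  show ?case
  proof (cases "y \<in> S")
    case True
    with step show ?thesis by (auto simp: adj_rel_def crosses_def) (metis fst_conv snd_conv)+
  qed (use step in auto)
qed auto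

lemma comp_of_not_crossed: "f \<in> F \<Longrightarrow> \<not> crosses ends (comp_of ends F x) f"
  unfolding crosses_def comp_of_def
  by (metis (no_types, lifting) adj_edge adj_rtrancl_sym mem_Collect_eq rtrancl_trans)

lemma comp_of_self: "x \<in> comp_of ends F x"
  by (simp add: comp_of_def)

text \<open>Induction on the number of edges: deleting \<open>f\<close> separates the component of
  one end from the remaining vertices. Both pieces carry smaller forests, and of the two units
  gained by adding their bounds one accounts for \<open>f\<close>.\<close>

lemma card_forest:
  assumes "finite F" "acyclic_edges ends F" "finite S" "S \<noteq> {}"
    and "\<And>f. f \<in> F \<Longrightarrow> fst (ends f) \<in> S \<and> snd (ends f) \<in> S"
  shows "card F + 1 \<le> card S"
  using assms
proof (induction "card F" arbitrary: F S rule: less_induct)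
  case less
  show ?case
  proof (cases "F = {}")
    case True
    then show ?thesis using less.prems card_gt_0_iff[of S] by auto
  next
    case False
    then obtain f where f: "f \<in> F" by auto
    define X where "X = S \<inter> comp_of ends (F - {f}) (fst (ends f))"
    define Y where "Y = S - X"
    let ?FX = "inside ends (F - {f}) X" and ?FY = "inside ends (F - {f}) Y"
    have "fst (ends f) \<in> X" "snd (ends f) \<in> Y"
      using less.prems(2,5) f comp_of_self
      by (auto simp: X_def Y_def acyclic_edges_def comp_of_def)
    then have ne: "X \<noteq> {}" "Y \<noteq> {}" by auto
    have split: "F - {f} = ?FX \<union> ?FY"
      using less.prems(5) comp_of_not_crossed[of _ "F - {f}" ends "fst (ends f)"]
      by (auto simp: inside_def X_def Y_def crosses_def)
    have disj: "?FX \<inter> ?FY = {}" by (auto simp: inside_def Y_def)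
    have fin: "finite ?FX" "finite ?FY" "finite X" "finite Y"
      using less.prems by (auto simp: inside_def X_def Y_def)
    have lt: "card ?FX < card F" "card ?FY < card F"
      using f less.prems(1) by (auto intro!: psubset_card_mono simp: inside_def)
    have ac: "acyclic_edges ends ?FX" "acyclic_edges ends ?FY"
      using less.prems(2) by (auto elim!: acyclic_edges_mono simp: inside_def)
    have "card ?FX + 1 \<le> card X"
      by (rule less.hyps[OF lt(1) fin(1) ac(1) fin(3) ne(1)]) (auto simp: inside_def)
    moreover have "card ?FY + 1 \<le> card Y"
      by (rule less.hyps[OF lt(2) fin(2) ac(2) fin(4) ne(2)]) (auto simp: inside_def)
    moreover have "card (F - {f}) = card ?FX + card ?FY"
      by (subst split) (simp only: card_Un_disjoint[OF fin(1,2) disj])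
    moreover have "card F = card (F - {f}) + 1"
      using f less.prems(1) by (metis Suc_eq_plus1 card_Suc_Diff1)
    moreover have "card S = card X + card Y"
    proof -
      have "X \<subseteq> S" by (auto simp: X_def)
      then show ?thesis unfolding Y_def using less.prems(3)
        by (metis card_Diff_subset card_mono finite_subset le_add_diff_inverse)
    qed
    ultimately show ?thesis by linarith
  qed
qed

text \<open>A vertex set is grown from a root: connectivity supplies an edge leaving the set, and
  adding its outer end \<open>z\<close> gains one vertex and at least one inner edge.\<close>

lemma card_connected:
  assumes "finite F" "finite V" "connected_on V ends F"
    and ends: "\<And>f. f \<in> F \<Longrightarrow> fst (ends f) \<in> V \<and> snd (ends f) \<in> V"
  shows "card V \<le> card F + 1"
proof (cases "V = {}")
  case False
  then obtain r where r: "r \<in> V" by auto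
  have "\<exists>X\<subseteq>V. card X = Suc k \<and> k \<le> card (inside ends F X)" if "k < card V" for k
    using that
  proof (induction k)
    case 0
    then show ?case using r by (intro exI[of _ "{r}"]) auto
  next
    case (Suc k)
    then obtain X where X: "X \<subseteq> V" "card X = Suc k" "k \<le> card (inside ends F X)" by auto
    have "X \<noteq> V" using X Suc.prems by auto
    then obtain y where y: "y \<in> V" "y \<notin> X" using X(1) by auto
    obtain x where x: "x \<in> X" using X(2) by (metis card.empty equals0I nat.distinct(1))
    have "(x, y) \<in> (adj_rel ends F)\<^sup>*" using assms(3) x y X(1) by (auto simp: connected_on_def)
    from crossing_edge_exists[OF this x y(2)]
    obtain f where f: "f \<in> F" "crosses ends X f" by auto
    define z where "z = (if fst (ends f) \<in> X then snd (ends f) else fst (ends f))"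
    have z: "z \<in> V" "z \<notin> X" using f ends by (auto simp: z_def crosses_def)
    have fin: "finite X" using X(1) assms(2) finite_subset by auto
    have "insert f (inside ends F X) \<subseteq> inside ends F (insert z X)"
      using f by (auto simp: inside_def z_def crosses_def)
    moreover have "finite (inside ends F (insert z X))" using assms(1) by (auto simp: inside_def)
    ultimately have "card (insert f (inside ends F X)) \<le> card (inside ends F (insert z X))"
      by (rule card_mono[rotated])
    moreover have "f \<notin> inside ends F X" using f by (auto simp: inside_def crosses_def)
    moreover have "finite (inside ends F X)" using assms(1) by (auto simp: inside_def)
    ultimately show ?case using X z fin by (intro exI[of _ "insert z X"]) auto
  qed
  from this[of "card V - 1"] obtain X where "card V - 1 \<le> card (inside ends F X)"
    using False assms(2) card_gt_0_iff[of V] by auto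
  moreover have "card (inside ends F X) \<le> card F"
    using assms(1) by (intro card_mono) (auto simp: inside_def)
  ultimately show ?thesis by linarith
qed auto

text \<open>The last step into \<open>w\<close> would use an edge incident to
  \<open>w\<close>.\<close>

lemma path_avoiding_end:
  assumes "(u, x) \<in> (adj_rel ends {h \<in> F. \<not> incident ends h w})\<^sup>*" "u \<noteq> w"
  shows "x \<noteq> w"
  using assms
  by (induction rule: rtrancl_induct) (auto simp: adj_rel_def incident_def, (metis fst_conv snd_conv)+)

text \<open>The edge found here is the first edge of the path in \<open>F\<close> from \<open>w\<close> to \<open>u\<close>.\<close>

lemma first_separating_edge:
  assumes ac: "acyclic_edges ends F" and con: "(u, w) \<in> (adj_rel ends F)\<^sup>*" and "u \<noteq> w"
  shows "\<exists>h\<in>F. incident ends h w \<and> (w, u) \<notin> (adj_rel ends (F - {h}))\<^sup>*"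
proof -
  let ?F' = "{h \<in> F. \<not> incident ends h w}"
  let ?X = "comp_of ends ?F' u"
  have "w \<notin> ?X" using path_avoiding_end[of u w ends F w] assms(3) by (auto simp: comp_of_def)
  from crossing_edge_exists[OF con comp_of_self[of u ends ?F'] this]
  obtain h where h: "h \<in> F" "crosses ends ?X h" by auto
  have inc: "incident ends h w"
    using comp_of_not_crossed[of h ?F' ends u] h by auto
  define x where "x = other_end ends h w"
  have "x \<in> ?X" using h(2) inc \<open>w \<notin> ?X\<close>
    by (auto simp: crosses_def incident_def x_def other_end_def)
  then have "(u, x) \<in> (adj_rel ends ?F')\<^sup>*" by (simp add: comp_of_def)
  then have ux: "(u, x) \<in> (adj_rel ends (F - {h}))\<^sup>*"
    by (rule adj_rtrancl_mono[rotated]) (use inc in auto)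
  have "(w, x) \<notin> (adj_rel ends (F - {h}))\<^sup>*"
    using ac h(1) inc adj_rtrancl_sym[of w x ends "F - {h}"]
    by (auto simp: acyclic_edges_def incident_def x_def other_end_def split: if_splits)
  then have "(w, u) \<notin> (adj_rel ends (F - {h}))\<^sup>*" using ux by (meson rtrancl_trans)
  then show ?thesis using h(1) inc by auto
qed

section \<open>Cyclic orbits\<close>

definition pos :: "('a \<Rightarrow> 'a) \<Rightarrow> 'a \<Rightarrow> 'a \<Rightarrow> nat" where
  "pos s a b = (LEAST n. (s ^^ n) a = b)"

definition cyclic_on :: "'a set \<Rightarrow> ('a \<Rightarrow> 'a) \<Rightarrow> bool" where
  "cyclic_on X s \<longleftrightarrow> (\<forall>a\<in>X. s a \<in> X) \<and> (\<forall>a\<in>X. \<forall>b\<in>X. \<exists>n. (s ^^ n) a = b)"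

lemma cyclic_on_funpow_in: "cyclic_on X s \<Longrightarrow> a \<in> X \<Longrightarrow> (s ^^ n) a \<in> X"
  by (induction n) (auto simp: cyclic_on_def)

text \<open>Transitivity applied to \<open>s a\<close> and \<open>a\<close> yields a positive return
  time. The least one, \<open>p\<close>, is the length of the cycle; the orbit exhausts
  \<open>X\<close>, so \<open>X\<close> is finite and \<open>card X\<close> is the period.\<close>

lemma cyclic_on_period:
  assumes "cyclic_on X s" "a \<in> X"
  shows "(s ^^ card X) a = a" "inj_on (\<lambda>n. (s ^^ n) a) {..<card X}"
    "(\<lambda>n. (s ^^ n) a) ` {..<card X} = X"
proof -
  define p where "p = (LEAST p. p > 0 \<and> (s ^^ p) a = a)"
  have "s a \<in> X" using assms by (auto simp: cyclic_on_def)
  then obtain n where "(s ^^ n) (s a) = a" using assms unfolding cyclic_on_def by blast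
  then have "Suc n > 0 \<and> (s ^^ Suc n) a = a" by (simp add: funpow_swap1)
  then have p: "p > 0" "(s ^^ p) a = a" unfolding p_def by (metis (mono_tags, lifting) LeastI)+
  have least: "\<not> (q > 0 \<and> (s ^^ q) a = a)" if "q < p" for q
    using that not_less_Least unfolding p_def by blast
  have ne: "(s ^^ i) a \<noteq> (s ^^ j) a" if "i < j" "j < p" for i j
  proof
    assume eq: "(s ^^ i) a = (s ^^ j) a"
    \<comment> \<open>Applying \<open>p - j\<close> further steps to both sides turns the
      coincidence into a return time smaller than \<open>p\<close>.\<close>
    have "(s ^^ (p - j + i)) a = (s ^^ (p - j)) ((s ^^ i) a)" by (simp add: funpow_add)
    also have "\<dots> = (s ^^ (p - j + j)) a" unfolding eq funpow_add by simp
    also have "\<dots> = a" using p that by simp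
    finally have "(s ^^ (p - j + i)) a = a" .
    moreover have "p - j + i > 0" "p - j + i < p" using that by auto
    ultimately show False using least[of "p - j + i"] by blast
  qed
  have inj: "inj_on (\<lambda>n. (s ^^ n) a) {..<p}"
    by (rule inj_onI) (metis lessThan_iff linorder_neqE_nat ne)
  have img: "(\<lambda>n. (s ^^ n) a) ` {..<p} = X"
  proof
    show "(\<lambda>n. (s ^^ n) a) ` {..<p} \<subseteq> X" using cyclic_on_funpow_in[OF assms] by auto
    show "X \<subseteq> (\<lambda>n. (s ^^ n) a) ` {..<p}"
    proof
      fix b assume "b \<in> X"
      then obtain n where "(s ^^ n) a = b" using assms unfolding cyclic_on_def by blast
      then have "(s ^^ (n mod p)) a = b" using funpow_mod_eq[OF p(2)] by simp
      then show "b \<in> (\<lambda>n. (s ^^ n) a) ` {..<p}" using p(1) by force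
    qed
  qed
  have "card X = p" using card_image[OF inj] img by simp
  then show "(s ^^ card X) a = a" "inj_on (\<lambda>n. (s ^^ n) a) {..<card X}"
    "(\<lambda>n. (s ^^ n) a) ` {..<card X} = X" using p inj img by auto
qed

lemma funpow_pos: "cyclic_on X s \<Longrightarrow> a \<in> X \<Longrightarrow> b \<in> X \<Longrightarrow> (s ^^ pos s a b) a = b"
  unfolding pos_def by (rule LeastI_ex) (auto simp: cyclic_on_def)

lemma pos_le: "(s ^^ n) a = b \<Longrightarrow> pos s a b \<le> n"
  unfolding pos_def by (rule Least_le)

lemma pos_less:
  assumes "cyclic_on X s" "a \<in> X" "b \<in> X"
  shows "pos s a b < card X"
proof -
  obtain n where "n < card X" "(s ^^ n) a = b"
    using cyclic_on_period(3)[OF assms(1,2)] assms(3) by force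
  then show ?thesis using pos_le[of n s a b] by linarith
qed

lemma pos_eqI:
  assumes "cyclic_on X s" "a \<in> X" "(s ^^ n) a = b" "n < card X"
  shows "pos s a b = n"
proof -
  have "b \<in> X" using cyclic_on_funpow_in[OF assms(1,2)] assms(3) by auto
  then show ?thesis
    using inj_onD[OF cyclic_on_period(2)[OF assms(1,2)], of "pos s a b" n]
      funpow_pos[OF assms(1,2)] pos_less[OF assms(1,2)] assms by auto
qed

lemma pos_inj:
  assumes "cyclic_on X s" "a \<in> X" "b \<in> X" "c \<in> X" "pos s a b = pos s a c"
  shows "b = c"
  using funpow_pos[OF assms(1,2)] assms(3-5) by metis

text \<open>Starting \<open>k\<close> steps later rotates the positions: those before
  \<open>k\<close> move behind all others. The value \<open>k = card X\<close> is allowed; it occurs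
  when the start vertex has only one edge.\<close>

lemma pos_shift:
  assumes cyc: "cyclic_on X s" and X: "a \<in> X" "c \<in> X"
    and k: "(s ^^ k) a = b" "k \<le> card X"
  shows "pos s b c = (if k \<le> pos s a c then pos s a c - k else pos s a c + card X - k)"
proof -
  have b: "b \<in> X" using cyclic_on_funpow_in[OF cyc X(1)] k by auto
  have lt: "pos s a c < card X" by (rule pos_less[OF cyc X])
  show ?thesis
  proof (cases "k \<le> pos s a c")
    case True
    have "(s ^^ (pos s a c - k)) b = (s ^^ (pos s a c - k + k)) a"
      using k(1) by (simp only: funpow_add o_apply)
    also have "\<dots> = c" using True funpow_pos[OF cyc X] by simp
    finally show ?thesis using pos_eqI[OF cyc b, of _ c] True lt by simp
  next
    case False
    have "(s ^^ (pos s a c + card X - k)) b = (s ^^ (pos s a c + card X - k + k)) a"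
      using k(1) by (simp only: funpow_add o_apply)
    also have "\<dots> = (s ^^ (pos s a c)) ((s ^^ card X) a)"
      using k(2) by (simp add: funpow_add)
    also have "\<dots> = c" using funpow_pos[OF cyc X] cyclic_on_period(1)[OF cyc X(1)] by simp
    finally show ?thesis using pos_eqI[OF cyc b, of _ c] False k(2) by simp
  qed
qed


text \<open>The first difference of two words of equal length decides their lexicographic order;
  this provides the descent in the surjectivity proof.\<close>

lemma map_upt_lex:
  assumes "k < N" "\<And>i. i < k \<Longrightarrow> d' i = d i" "d' k < (d k :: nat)"
  shows "(map d' [0..<N], map d [0..<N]) \<in> lex less_than"
proof -
  have split: "[0..<N] = [0..<k] @ k # [Suc k..<N]"
    using assms(1) by (metis less_imp_add_positive plus_nat.add_0 upt_add_eq_append upt_conv_Cons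
        add.commute zero_le less_or_eq_imp_le le_add_diff_inverse)
  have "map d' [0..<k] = map d [0..<k]" using assms(2) by simp
  then show ?thesis unfolding split lex_conv using assms(3)
    by (auto intro!: exI[of _ "map d [0..<k]"])
qed

section \<open>Divisors\<close>

lemma int_card_filter: "finite A \<Longrightarrow> int (card {f \<in> A. P f}) = (\<Sum>f\<in>A. of_bool (P f))"
  by (simp add: Int_def flip: sum.inter_filter)

lemma sum_fibre_card:
  assumes "finite A" "finite S"
  shows "(\<Sum>u\<in>S. int (card {f \<in> A. c f = u})) = int (card {f \<in> A. c f \<in> S})"
proof -
  have "(\<Sum>u\<in>S. int (card {f \<in> A. c f = u})) = (\<Sum>f\<in>A. \<Sum>u\<in>S. of_bool (c f = u))"
    by (simp only: int_card_filter[OF assms(1)]) (rule sum.swap)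
  also have "\<dots> = (\<Sum>f\<in>A. of_bool (c f \<in> S))"
    using assms(2) by (intro sum.cong refl) (simp add: of_bool_def)
  finally show ?thesis by (simp only: int_card_filter[OF assms(1)])
qed

lemma lin_equiv_refl: "lin_equiv E ends D D"
  unfolding lin_equiv_def by (rule exI[of _ "\<lambda>_. 0"]) (simp add: laplacian_def)

lemma lin_equiv_sym:
  assumes "lin_equiv E ends D D'"
  shows "lin_equiv E ends D' D"
proof -
  obtain f where f: "(\<lambda>u. D u - D' u) = laplacian E ends f" using assms by (auto simp: lin_equiv_def)
  have "D' u - D u = laplacian E ends (\<lambda>x. - f x) u" for u
  proof -
    have "D' u - D u = - laplacian E ends f u" using fun_cong[OF f, of u] by simp
    then show ?thesis by (simp add: laplacian_def flip: sum_negf)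
  qed
  then show ?thesis unfolding lin_equiv_def by blast
qed

lemma lin_equiv_trans:
  assumes "lin_equiv E ends D D'" "lin_equiv E ends D' D''"
  shows "lin_equiv E ends D D''"
proof -
  obtain f g where f: "(\<lambda>u. D u - D' u) = laplacian E ends f"
    and g: "(\<lambda>u. D' u - D'' u) = laplacian E ends g"
    using assms by (auto simp: lin_equiv_def)
  have "D u - D'' u = laplacian E ends (\<lambda>x. f x + g x) u" for u
  proof -
    have "D u - D'' u = laplacian E ends f u + laplacian E ends g u"
      using fun_cong[OF f, of u] fun_cong[OF g, of u] by simp
    then show ?thesis by (simp add: laplacian_def algebra_simps flip: sum.distrib)
  qed
  then show ?thesis unfolding lin_equiv_def by blast
qed

lemma lin_equiv_add_cong:
  "lin_equiv E ends D D' \<Longrightarrow> lin_equiv E ends (\<lambda>u. D u + X u) (\<lambda>u. D' u + X u)"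
  by (simp add: lin_equiv_def)

lemma lin_equiv_add_cong2:
  "lin_equiv E ends D D' \<Longrightarrow> lin_equiv E ends (\<lambda>u. X u + D u) (\<lambda>u. X u + D' u)"
  by (simp add: lin_equiv_def)

section \<open>Ribbon graphs and the tour of a spanning tree\<close>

locale ribbon =
  fixes V :: "'v set" and E :: "'e set" and ends :: "'e \<Rightarrow> 'v \<times> 'v"
    and rot :: "'v \<Rightarrow> 'e \<Rightarrow> 'e"
  assumes ribbon_graph: "ribbon_graph V E ends rot"
begin

abbreviation "trees \<equiv> spanning_trees V E ends"
abbreviation "inc \<equiv> incident ends"
abbreviation "opp \<equiv> other_end ends"
abbreviation "step \<equiv> tour_step ends rot"

text \<open>The half-edges, which are the possible states of the tour. For a spanning tree the tour
  runs through all of them in one cycle.\<close>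

definition flags :: "('v \<times> 'e) set" where
  "flags = {(u, f). f \<in> E \<and> inc f u}"

lemma finite_V: "finite V" and finite_E: "finite E" and V_nonempty: "V \<noteq> {}"
  and connected_E: "connected_on V ends E"
  using ribbon_graph by (auto simp: ribbon_graph_def graph_def)

lemma ends_V: "f \<in> E \<Longrightarrow> fst (ends f) \<in> V" "f \<in> E \<Longrightarrow> snd (ends f) \<in> V"
  and no_loop: "f \<in> E \<Longrightarrow> fst (ends f) \<noteq> snd (ends f)"
  using ribbon_graph by (auto simp: ribbon_graph_def graph_def)

lemma inc_V: "f \<in> E \<Longrightarrow> inc f u \<Longrightarrow> u \<in> V"
  using ends_V by (auto simp: incident_def)

lemma flags_iff: "(u, f) \<in> flags \<longleftrightarrow> f \<in> E \<and> inc f u"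
  by (simp add: flags_def)

lemma flags_V: "s \<in> flags \<Longrightarrow> fst s \<in> V"
  using inc_V by (auto simp: flags_def)

lemma flags_inc_edges: "(u, f) \<in> flags \<longleftrightarrow> u \<in> V \<and> f \<in> inc_edges E ends u"
  using inc_V by (auto simp: flags_def inc_edges_def)

lemma finite_flags: "finite flags"
proof (rule finite_subset)
  show "flags \<subseteq> V \<times> E" using inc_V by (auto simp: flags_def)
qed (use finite_V finite_E in auto)

lemma
  assumes "f \<in> E" "inc f u"
  shows inc_opp: "inc f (opp f u)" and opp_neq: "opp f u \<noteq> u"
    and opp_opp: "opp f (opp f u) = u"
    and inc_cases: "inc f x \<longleftrightarrow> x = u \<or> x = opp f u"
  using assms no_loop[OF assms(1)] by (auto simp: incident_def other_end_def)

lemma rot_flags: "(u, f) \<in> flags \<Longrightarrow> (u, rot u f) \<in> flags"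
  using ribbon_graph by (auto simp: flags_inc_edges ribbon_graph_def bij_betw_def)

lemma rot_inj: "(u, f) \<in> flags \<Longrightarrow> (u, g) \<in> flags \<Longrightarrow> rot u f = rot u g \<Longrightarrow> f = g"
  using ribbon_graph
  by (auto simp: flags_inc_edges ribbon_graph_def bij_betw_def dest: inj_onD)

lemma rot_transitive: "(u, f) \<in> flags \<Longrightarrow> (u, g) \<in> flags \<Longrightarrow> \<exists>n. (rot u ^^ n) f = g"
  using ribbon_graph by (auto simp: flags_inc_edges ribbon_graph_def)

lemma crosses_iff:
  "f \<in> E \<Longrightarrow> inc f u \<Longrightarrow> crosses ends S f \<longleftrightarrow> (u \<in> S) \<noteq> (opp f u \<in> S)"
  by (auto simp: crosses_def incident_def other_end_def)

lemma step_eq: "step T (u, f) = (if f \<in> T then (opp f u, rot (opp f u) f) else (u, rot u f))"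
  by (simp add: tour_step_def Let_def)

lemma step_flags: "s \<in> flags \<Longrightarrow> step T s \<in> flags"
  using inc_opp rot_flags by (cases s) (auto simp: step_eq flags_iff)

lemma funpow_step_flags: "s \<in> flags \<Longrightarrow> (step T ^^ n) s \<in> flags"
  by (induction n) (auto simp: step_flags)

text \<open>A step can be undone: the examined edge is the predecessor of the new edge at the new
  vertex, and whether it lies in \<open>T\<close> tells whether the old vertex was the opposite end
  or the same one.\<close>

lemma step_inj:
  assumes "s \<in> flags" "t \<in> flags" "step T s = step T t"
  shows "s = t"
proof -
  obtain u f w g where st: "s = (u, f)" "t = (w, g)" by fastforce
  have fg: "f \<in> E" "inc f u" "g \<in> E" "inc g w" using assms st by (auto simp: flags_iff)
  note o = opp_opp[OF fg(1,2)] opp_opp[OF fg(3,4)] inc_opp[OF fg(1,2)] inc_opp[OF fg(3,4)]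
  define x where "x = fst (step T s)"
  have x': "x = fst (step T t)" by (simp add: x_def assms(3))
  have "rot x f = rot x g" using assms(3) unfolding st x_def by (auto simp: step_eq split: if_splits)
  moreover have "(x, f) \<in> flags" using fg o(3) by (auto simp: st x_def step_eq flags_iff)
  moreover have "(x, g) \<in> flags"
    using step_flags[OF assms(2), of T] fg o(4) x' by (auto simp: st step_eq flags_iff)
  ultimately have "f = g" by (rule rot_inj[rotated 2])
  moreover from this have "(if f \<in> T then opp f u else u) = (if f \<in> T then opp f w else w)"
    using assms(3) unfolding st step_eq by (metis fst_conv)
  ultimately have "u = w" using o(1,2) by metis
  then show ?thesis using \<open>f = g\<close> st by simp
qed

text \<open>On a finite set some state is repeated, and injectivity cancels the steps before its
  first occurrence.\<close>

lemma step_recurrent: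
  assumes "s \<in> flags"
  shows "\<exists>n>0. (step T ^^ n) s = s"
proof -
  have cancel: "(step T ^^ j) s = s" if "(step T ^^ i) s = (step T ^^ (i + j)) s" for i j
    using that
  proof (induction i)
    case (Suc i)
    have "(step T ^^ i) s = (step T ^^ (i + j)) s"
      by (rule step_inj[of _ _ T]) (use Suc.prems funpow_step_flags[OF assms] in auto)
    then show ?case by (rule Suc.IH)
  qed simp
  have "\<not> inj (\<lambda>n. (step T ^^ n) s)"
  proof
    assume "inj (\<lambda>n. (step T ^^ n) s)"
    moreover have "range (\<lambda>n. (step T ^^ n) s) \<subseteq> flags"
      using funpow_step_flags[OF assms] by auto
    ultimately show False using finite_flags
      by (metis finite_imageD finite_subset infinite_UNIV_nat)
  qed
  then obtain i j where ij: "i < j" "(step T ^^ i) s = (step T ^^ j) s"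
    unfolding inj_def by (metis linorder_neqE_nat)
  then have "(step T ^^ (j - i)) s = s" using cancel[of i "j - i"] by simp
  then show ?thesis using ij(1) by (intro exI[of _ "j - i"]) auto
qed

section \<open>Fundamental cuts of a spanning tree and the order of the tour\<close>

lemma tree_edges: "T \<in> trees \<Longrightarrow> T \<subseteq> E"
  and tree_connected: "T \<in> trees \<Longrightarrow> connected_on V ends T"
  and tree_acyclic: "T \<in> trees \<Longrightarrow> acyclic_edges ends T"
  by (auto simp: spanning_trees_def acyclic_edges_def)

text \<open>For a tree edge \<open>h\<close> this is its fundamental cut. The side is kept inside
  \<open>V\<close> so that \<open>V - S\<close> can serve as the other side.\<close>

definition cut_by :: "'e set \<Rightarrow> 'v set \<Rightarrow> 'e \<Rightarrow> bool" where
  "cut_by T S h \<longleftrightarrow> S \<subseteq> V \<and> (\<forall>g\<in>T. crosses ends S g \<longleftrightarrow> g = h)"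

lemma cut_by_compl: "T \<subseteq> E \<Longrightarrow> cut_by T S h \<Longrightarrow> cut_by T (V - S) h"
  using ends_V by (auto simp: cut_by_def crosses_def)

lemma comp_of_V:
  assumes "F \<subseteq> E" "x \<in> V"
  shows "comp_of ends F x \<subseteq> V"
proof
  fix y assume "y \<in> comp_of ends F x"
  then have "(x, y) \<in> (adj_rel ends F)\<^sup>*" by (simp add: comp_of_def)
  then show "y \<in> V" using assms(2)
  proof (induction rule: rtrancl_induct)
    case (step y z)
    then obtain f where "f \<in> F" "(y, z) = ends f \<or> (z, y) = ends f" by (auto simp: adj_rel_def)
    then show ?case using ends_V[of f] assms(1) by (metis fst_conv snd_conv subsetD)
  qed
qed

lemma tree_cut:
  assumes T: "T \<in> trees" and h: "h \<in> T" "inc h b"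
  defines "S \<equiv> comp_of ends (T - {h}) b"
  shows "b \<in> S" "opp h b \<notin> S" "cut_by T S h"
proof -
  have hE: "h \<in> E" using tree_edges[OF T] h by auto
  show b: "b \<in> S" by (simp add: S_def comp_of_self)
  have "(b, opp h b) \<notin> (adj_rel ends (T - {h}))\<^sup>*"
    using tree_acyclic[OF T] h adj_rtrancl_sym[of b "opp h b" ends "T - {h}"]
    by (auto simp: acyclic_edges_def incident_def other_end_def split: if_splits)
  then show o: "opp h b \<notin> S" by (simp add: S_def comp_of_def)
  have "S \<subseteq> V" unfolding S_def
    by (rule comp_of_V) (use tree_edges[OF T] inc_V[OF hE h(2)] in auto)
  moreover have "crosses ends S g \<longleftrightarrow> g = h" if "g \<in> T" for g
    using that comp_of_not_crossed[of g "T - {h}" ends b] crosses_iff[OF hE h(2), of S] b o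
    by (auto simp: S_def)
  ultimately show "cut_by T S h" by (simp add: cut_by_def)
qed

text \<open>A step changes sides only by walking along a tree edge that crosses the cut, and
  \<open>h\<close> is the only one; it enters \<open>S\<close> from \<open>opp h b\<close> and
  leaves it from \<open>b\<close>.\<close>

lemma step_in_iff:
  assumes T: "T \<subseteq> E" and s: "s \<in> flags" and cut: "cut_by T S h" and h: "h \<in> T" "inc h b" "b \<in> S"
  shows "fst (step T s) \<in> S \<longleftrightarrow> s = (opp h b, h) \<or> (fst s \<in> S \<and> s \<noteq> (b, h))"
proof -
  obtain u f where uf: "s = (u, f)" by fastforce
  have f: "f \<in> E" "inc f u" using s by (auto simp: uf flags_iff)
  have hE: "h \<in> E" using T h by auto
  have "crosses ends S h" using cut h by (auto simp: cut_by_def)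
  then have o: "opp h b \<notin> S" using crosses_iff[OF hE h(2)] h(3) by auto
  show ?thesis
  proof (cases "f \<in> T")
    case True
    show ?thesis
    proof (cases "f = h")
      case True
      then have "u = b \<or> u = opp h b" using inc_cases[OF hE h(2)] f by auto
      then show ?thesis
        using True h o opp_opp[OF hE h(2)] by (auto simp: uf step_eq)
    next
      case False
      then have "(u \<in> S) = (opp f u \<in> S)" using crosses_iff[OF f, of S] cut True by (auto simp: cut_by_def)
      then show ?thesis using True False by (auto simp: uf step_eq)
    qed
  next
    case False
    then show ?thesis using h by (auto simp: uf step_eq)
  qed
qed

text \<open>If \<open>f\<close> is a tree edge, the tour leaves \<open>u\<close> along \<open>f\<close>; being recurrent it comes back, and
  the only way back is along \<open>f\<close> again.\<close>

lemma tour_reaches_next_edge: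
  assumes T: "T \<in> trees" and s: "(u, f) \<in> flags"
  shows "\<exists>n. (step T ^^ n) (u, f) = (u, rot u f)"
proof (cases "f \<in> T")
  case False
  then show ?thesis by (intro exI[of _ 1]) (simp add: step_eq)
next
  case True
  let ?w = "opp f u"
  have f: "f \<in> E" "inc f u" using s by (auto simp: flags_iff)
  define S where "S = comp_of ends (T - {f}) ?w"
  have S: "?w \<in> S" "u \<notin> S" "cut_by T S f"
    using tree_cut[OF T True inc_opp[OF f]] opp_opp[OF f] by (auto simp: S_def)
  define Q where "Q n \<longleftrightarrow> fst ((step T ^^ n) (u, f)) \<in> S" for n
  have "Q 1" using S(1) True by (simp add: Q_def step_eq)
  obtain p where p: "p > 0" "(step T ^^ p) (u, f) = (u, f)" using step_recurrent[OF s] by auto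
  then have "\<not> Q p" using S(2) by (simp add: Q_def)
  have "\<exists>n. Q n \<and> \<not> Q (Suc n)"
  proof (rule ccontr)
    assume "\<nexists>n. Q n \<and> \<not> Q (Suc n)"
    then have "Q (Suc n)" for n using \<open>Q 1\<close> by (induction n) auto
    then show False using p(1) \<open>\<not> Q p\<close> by (metis Suc_pred)
  qed
  then obtain n where n: "Q n" "\<not> Q (Suc n)" by auto
  have "(step T ^^ n) (u, f) = (?w, f)"
    using n step_in_iff[OF tree_edges[OF T] funpow_step_flags[OF s, of n T] S(3) True inc_opp[OF f] S(1)]
    by (auto simp: Q_def)
  then have "(step T ^^ Suc n) (u, f) = (u, rot u f)"
    using True opp_opp[OF f] by (simp add: step_eq)
  then show ?thesis by blast
qed

text \<open>The tour always reaches the next edge at the same vertex, hence all edges there; tree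
  edges lead to the neighbours, and connectedness of the tree does the rest.\<close>

lemma cyclic_tour:
  assumes T: "T \<in> trees"
  shows "cyclic_on flags (step T)"
proof -
  define reach where "reach s t \<longleftrightarrow> (\<exists>n. (step T ^^ n) s = t)" for s t
  have trans: "reach r t" if "reach r s" "reach s t" for r s t
    using that unfolding reach_def by (metis comp_apply funpow_add)
  have next_edge: "reach (u, f) (u, rot u f)" if "(u, f) \<in> flags" for u f
    using tour_reaches_next_edge[OF T that] by (simp add: reach_def)
  have refl: "reach s s" for s unfolding reach_def by (rule exI[of _ 0]) simp
  have rot_pow: "(u, (rot u ^^ n) f) \<in> flags \<and> reach (u, f) (u, (rot u ^^ n) f)"
    if "(u, f) \<in> flags" for u f n
  proof (induction n)
    case (Suc n)
    then show ?case
      using rot_flags[of u "(rot u ^^ n) f"] next_edge[of u "(rot u ^^ n) f"]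
        trans[of "(u, f)" "(u, (rot u ^^ n) f)" "(u, rot u ((rot u ^^ n) f))"]
      by simp
  qed (simp add: that refl)
  have vertex: "reach (u, f) (u, g)" if "(u, f) \<in> flags" "(u, g) \<in> flags" for u f g
    using rot_transitive[OF that] rot_pow[OF that(1)] by metis
  have across: "reach (u, f) (w, g)"
    if uw: "(u, w) \<in> adj_rel ends T" and f: "(u, f) \<in> flags" and g: "(w, g) \<in> flags" for u w f g
  proof -
    obtain h where h: "h \<in> T" "(u, w) = ends h \<or> (w, u) = ends h" using uw by (auto simp: adj_rel_def)
    have hE: "h \<in> E" using h tree_edges[OF T] by auto
    have hu: "inc h u" "opp h u = w"
      using h(2) no_loop[OF hE] unfolding incident_def other_end_def by (metis fst_conv snd_conv)+
    have "reach (u, f) (u, h)" using vertex[OF f] hE hu by (simp add: flags_iff)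
    moreover have "reach (u, h) (w, rot w h)"
      unfolding reach_def using h hu by (intro exI[of _ 1]) (simp add: step_eq)
    moreover have "(w, rot w h) \<in> flags"
      using rot_flags inc_opp[OF hE hu(1)] hE by (simp add: hu flags_iff)
    ultimately show ?thesis using trans vertex g by blast
  qed
  have nonisolated: "\<exists>f. (w, f) \<in> flags" if uw: "(u, w) \<in> adj_rel ends T" for u w
  proof -
    obtain h where "h \<in> T" "(u, w) = ends h \<or> (w, u) = ends h" using uw by (auto simp: adj_rel_def)
    then show ?thesis
      using tree_edges[OF T] unfolding flags_iff incident_def by (metis fst_conv snd_conv subsetD)
  qed
  have "reach (u, f) (w, g)" if f: "(u, f) \<in> flags" and g: "(w, g) \<in> flags" for u f w g
  proof -
    have "(u, w) \<in> (adj_rel ends T)\<^sup>*"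
      using tree_connected[OF T] f g flags_V by (fastforce simp: connected_on_def)
    then have "\<forall>g. (w, g) \<in> flags \<longrightarrow> reach (u, f) (w, g)"
    proof (induction rule: rtrancl_induct)
      case base
      then show ?case using vertex[OF f] by auto
    next
      case (step y z)
      have "(z, y) \<in> adj_rel ends T" using step.hyps(2) by (rule adj_rel_sym)
      then obtain k where "(y, k) \<in> flags" using nonisolated by blast
      then show ?case using step across trans by blast
    qed
    then show ?thesis using g by blast
  qed
  then show ?thesis using step_flags by (auto simp: cyclic_on_def reach_def)
qed

text \<open>In one period \<open>h\<close> is walked once into \<open>S\<close> and once out of it.
  The first inequality is strict because at \<open>(opp h b, h)\<close> the tour is still outside;
  the second is not because at \<open>(b, h)\<close> it is still inside.\<close>

lemma visit_interval:
  assumes T: "T \<in> trees" and s: "s \<in> flags" and cut: "cut_by T S h"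
    and h: "h \<in> T" "inc h b" "b \<in> S" and out: "fst s \<notin> S" and xg: "(x, g) \<in> flags"
  shows "x \<in> S \<longleftrightarrow> pos (step T) s (opp h b, h) < pos (step T) s (x, g) \<and>
                   pos (step T) s (x, g) \<le> pos (step T) s (b, h)"
proof -
  let ?p = "pos (step T) s" and ?N = "card flags"
  note cyc = cyclic_tour[OF T]
  have hE: "h \<in> E" using tree_edges[OF T] h by auto
  have fl: "(b, h) \<in> flags" "(opp h b, h) \<in> flags"
    using hE h inc_opp[OF hE h(2)] by (auto simp: flags_iff)
  define Q where "Q n \<longleftrightarrow> fst ((step T ^^ n) s) \<in> S" for n
  define i where "i = ?p (opp h b, h)"
  define j where "j = ?p (b, h)"
  \<comment> \<open>Each flag occurs exactly once in a period, so being at the entry or exit flag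
    becomes \<open>n = i\<close> or \<open>n = j\<close>.\<close>
  have at: "(step T ^^ n) s = t \<longleftrightarrow> n = ?p t" if "t \<in> flags" "n < ?N" for n t
    using funpow_pos[OF cyc s that(1)] pos_eqI[OF cyc s _ that(2)] by auto
  have Q0: "\<not> Q 0" using out by (simp add: Q_def)
  have QS: "Q (Suc n) \<longleftrightarrow> n = i \<or> (Q n \<and> n \<noteq> j)" if "n < ?N" for n
    using step_in_iff[OF tree_edges[OF T] funpow_step_flags[OF s, of n T] cut h]
      at[OF fl(1) that] at[OF fl(2) that]
    by (auto simp: Q_def i_def j_def)
  have "Q j" using funpow_pos[OF cyc s fl(1)] h(3) by (simp add: Q_def j_def)
  have lt: "i < ?N" "j < ?N" using pos_less[OF cyc s] fl by (auto simp: i_def j_def)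
  have low: "i < n" if "Q n" "n \<le> ?N" for n
    using that Q0 QS by (induction n) (auto simp: less_Suc_eq_le Suc_le_eq)
  have ij: "i < j" using low[OF \<open>Q j\<close>] lt by auto
  \<comment> \<open>After leaving at time \<open>j\<close> the tour cannot come back within the
    period, since the only entry time \<open>i\<close> is past.\<close>
  have high: "\<not> Q (Suc j + k)" if "Suc j + k \<le> ?N" for k
    using that QS ij by (induction k) auto
  have mid: "Q (Suc i + k)" if "Suc i + k \<le> j" for k
    using that QS lt by (induction k) auto
  have Q_iff: "Q n \<longleftrightarrow> i < n \<and> n \<le> j" if "n < ?N" for n
  proof
    assume "Q n"
    then show "i < n \<and> n \<le> j"
      using low[of n] high[of "n - Suc j"] that by (cases "n \<le> j") auto
  next
    assume "i < n \<and> n \<le> j"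
    then show "Q n" using mid[of "n - Suc i"] by auto
  qed
  have "(step T ^^ ?p (x, g)) s = (x, g)" by (rule funpow_pos[OF cyc s xg])
  then show ?thesis
    using Q_iff[OF pos_less[OF cyc s xg]] by (simp add: Q_def i_def j_def)
qed

section \<open>The end from which an edge is first cut\<close>

lemma tour_funpow: "tour ends rot v e T n = (step T ^^ n) (v, e)"
  by (simp add: tour_def)

text \<open>An edge belongs to exactly two flags, so it is first examined at the smaller of their
  two positions.\<close>

lemma eta_eq:
  assumes T: "T \<in> trees" and s: "(v, e) \<in> flags" and f: "f \<in> E" "inc f x"
  shows "bernardi_eta ends rot v e T f =
    (if pos (step T) (v, e) (x, f) < pos (step T) (v, e) (opp f x, f) then x else opp f x)"
proof -
  let ?p = "pos (step T) (v, e)"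
  note cyc = cyclic_tour[OF T]
  define z where "z = (if ?p (x, f) < ?p (opp f x, f) then x else opp f x)"
  have fl: "(x, f) \<in> flags" "(opp f x, f) \<in> flags" using f inc_opp[OF f] by (auto simp: flags_iff)
  then have zf: "(z, f) \<in> flags" by (simp add: z_def)
  have "(LEAST n. snd ((step T ^^ n) (v, e)) = f) = ?p (z, f)"
  proof (rule Least_equality)
    show "snd ((step T ^^ ?p (z, f)) (v, e)) = f" by (simp add: funpow_pos[OF cyc s zf])
    fix n assume n: "snd ((step T ^^ n) (v, e)) = f"
    define w where "w = fst ((step T ^^ n) (v, e))"
    have w: "(step T ^^ n) (v, e) = (w, f)" by (simp add: w_def prod_eq_iff n)
    then have "inc f w" using funpow_step_flags[OF s, of n T] by (simp add: flags_iff)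
    then have "w = x \<or> w = opp f x" using inc_cases[OF f] by auto
    then show "?p (z, f) \<le> n" using pos_le[OF w] by (auto simp: z_def)
  qed
  then show ?thesis
    using funpow_pos[OF cyc s zf] by (simp add: bernardi_eta_def tour_funpow z_def)
qed

lemma eta_inc:
  assumes "T \<in> trees" "(v, e) \<in> flags" "f \<in> E"
  shows "inc f (bernardi_eta ends rot v e T f)"
proof -
  have "inc f (fst (ends f))" by (simp add: incident_def)
  then show ?thesis using eta_eq[OF assms] inc_opp[OF assms(3)] by auto
qed

end


context ribbon
begin

section \<open>Break divisors\<close>

text \<open>Collecting the Laplacian by edges lets it be compared edge by edge with chip counts. The
  orientation given by \<open>ends\<close> is immaterial, since reversing an edge changes the sign
  of both factors.\<close>

lemma laplacian_edge_sum:
  "laplacian E ends f u = (\<Sum>g\<in>E. (f (fst (ends g)) - f (snd (ends g))) *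
     (of_bool (fst (ends g) = u) - of_bool (snd (ends g) = u)))"
proof -
  have "laplacian E ends f u = (\<Sum>g\<in>E. if inc g u then f u - f (opp g u) else 0)"
    unfolding laplacian_def inc_edges_def using finite_E by (simp only: sum.inter_filter)
  also have "\<dots> = (\<Sum>g\<in>E. (f (fst (ends g)) - f (snd (ends g))) *
     (of_bool (fst (ends g) = u) - of_bool (snd (ends g) = u)))"
    using no_loop by (intro sum.cong refl) (auto simp: incident_def other_end_def)
  finally show ?thesis .
qed

lemma laplacian_sum_on:
  assumes "finite S"
  shows "(\<Sum>u\<in>S. laplacian E ends f u) = (\<Sum>g\<in>E. (f (fst (ends g)) - f (snd (ends g))) *
     (of_bool (fst (ends g) \<in> S) - of_bool (snd (ends g) \<in> S)))"
proof -
  have b: "(\<Sum>u\<in>S. of_bool (x = u)) = (of_bool (x \<in> S) :: int)" for x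
    using assms by (simp add: of_bool_def)
  show ?thesis
    unfolding laplacian_edge_sum
    by (subst sum.swap) (simp add: sum_subtractf b flip: sum_distrib_left)
qed

section \<open>Edge counts and edge exchange for spanning trees\<close>

lemma finite_tree: "T \<in> trees \<Longrightarrow> finite T"
  using tree_edges finite_E finite_subset by blast

lemma card_inside_tree:
  assumes "T \<in> trees" "S \<subseteq> V" "S \<noteq> {}"
  shows "card (inside ends T S) + 1 \<le> card S"
proof (rule card_forest)
  show "finite (inside ends T S)" using finite_tree[OF assms(1)] by (simp add: inside_def)
  show "acyclic_edges ends (inside ends T S)"
    by (rule acyclic_edges_mono[OF tree_acyclic[OF assms(1)]]) (auto simp: inside_def)
  show "finite S" using assms(2) finite_V finite_subset by blast
qed (use assms in \<open>auto simp: inside_def\<close>)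

lemma inside_V: "F \<subseteq> E \<Longrightarrow> inside ends F V = F"
  using ends_V by (auto simp: inside_def)

lemma card_tree:
  assumes "T \<in> trees"
  shows "card T + 1 = card V"
proof (rule antisym)
  show "card T + 1 \<le> card V"
    using card_inside_tree[OF assms subset_refl V_nonempty] inside_V[OF tree_edges[OF assms]] by simp
  show "card V \<le> card T + 1"
    using finite_tree[OF assms] finite_V tree_connected[OF assms] tree_edges[OF assms] ends_V
    by (intro card_connected) auto
qed

lemma connected_diff:
  assumes "connected_on V ends F" "(fst (ends g), snd (ends g)) \<in> (adj_rel ends (F - {g}))\<^sup>*"
  shows "connected_on V ends (F - {g})"
proof -
  have "(x, y) \<in> (adj_rel ends (F - {g}))\<^sup>*" if xy: "(x, y) \<in> adj_rel ends F" for x y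
  proof -
    obtain f where f: "f \<in> F" "(x, y) = ends f \<or> (y, x) = ends f"
      using xy by (auto simp: adj_rel_def)
    show ?thesis
    proof (cases "f = g")
      case True
      then show ?thesis using f(2) assms(2) adj_rtrancl_sym[OF assms(2)] by (metis fst_conv snd_conv)
    next
      case False
      then show ?thesis using f by (intro r_into_rtrancl) (auto simp: adj_rel_def)
    qed
  qed
  then have "adj_rel ends F \<subseteq> (adj_rel ends (F - {g}))\<^sup>*" by auto
  then have "(adj_rel ends F)\<^sup>* \<subseteq> (adj_rel ends (F - {g}))\<^sup>*" by (rule rtrancl_subset_rtrancl)
  then show ?thesis using assms(1) by (auto simp: connected_on_def)
qed

text \<open>An edge on a cycle could be deleted without losing connectedness, leaving too few edges
  to connect \<open>V\<close>.\<close>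

lemma tree_if_card:
  assumes F: "F \<subseteq> E" "connected_on V ends F" "card F + 1 = card V"
  shows "F \<in> trees"
proof -
  have "(fst (ends g), snd (ends g)) \<notin> (adj_rel ends (F - {g}))\<^sup>*" if g: "g \<in> F" for g
  proof
    assume "(fst (ends g), snd (ends g)) \<in> (adj_rel ends (F - {g}))\<^sup>*"
    then have "connected_on V ends (F - {g})" by (rule connected_diff[OF F(2)])
    moreover have fin: "finite F" using F(1) finite_E finite_subset by blast
    ultimately have "card V \<le> card (F - {g}) + 1"
      using F(1) ends_V finite_V by (intro card_connected) auto
    moreover have "card (F - {g}) < card F" using g fin by (intro psubset_card_mono) auto
    ultimately show False using F(3) by simp
  qed
  then show ?thesis using F by (auto simp: spanning_trees_def)
qed

text \<open>Deleting \<open>h\<close> leaves the components of its two ends and \<open>f\<close>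
  joins them again; the number of edges is unchanged, so the connected result is a tree.\<close>

lemma tree_exchange:
  assumes T: "T \<in> trees" and h: "h \<in> T" "inc h b" and f: "f \<in> E" "f \<notin> T"
    and cr: "crosses ends (comp_of ends (T - {h}) b) f"
  shows "insert f (T - {h}) \<in> trees"
proof (rule tree_if_card)
  let ?T' = "insert f (T - {h})"
  let ?a = "opp h b"
  let ?B = "comp_of ends (T - {h}) b" and ?A = "comp_of ends (T - {h}) ?a"
  have hE: "h \<in> E" using tree_edges[OF T] h by auto
  show "?T' \<subseteq> E" using tree_edges[OF T] f by auto
  \<comment> \<open>A tree path from \<open>b\<close> to a vertex in neither component would leave
    their union along a tree edge other than \<open>h\<close>, but such edges stay within a
    component.\<close>
  have cover: "y \<in> ?A \<union> ?B" if "y \<in> V" for y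
  proof (rule ccontr)
    assume y: "y \<notin> ?A \<union> ?B"
    have "(b, y) \<in> (adj_rel ends T)\<^sup>*"
      using tree_connected[OF T] inc_V[OF hE h(2)] that by (auto simp: connected_on_def)
    from crossing_edge_exists[OF this _ y] comp_of_self[of b ends]
    obtain g where g: "g \<in> T" "crosses ends (?A \<union> ?B) g" by blast
    have "g \<noteq> h" using g(2) crosses_iff[OF hE h(2), of "?A \<union> ?B"]
      comp_of_self[of ?a ends "T - {h}"] comp_of_self[of b ends "T - {h}"] by auto
    then show False
      using g comp_of_not_crossed[of g "T - {h}" ends b] comp_of_not_crossed[of g "T - {h}" ends ?a]
      by (auto simp: crosses_def)
  qed
  have reach: "(x, y) \<in> (adj_rel ends ?T')\<^sup>*" if "y \<in> comp_of ends (T - {h}) x" for x y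
    using that adj_rtrancl_mono[of "T - {h}" ?T' x y ends] by (auto simp: comp_of_def)
  obtain x y where xy: "x \<in> ?B" "y \<notin> ?B" "inc f x" "y = opp f x"
    using cr by (auto simp: crosses_def incident_def other_end_def) (metis no_loop f(1))+
  have "y \<in> ?A" using cover[of y] xy inc_V[OF f(1) inc_opp[OF f(1) xy(3)]] by auto
  have "(x, y) \<in> (adj_rel ends ?T')\<^sup>*"
    using xy(3,4) by (intro r_into_rtrancl)
      (auto simp: adj_rel_def incident_def other_end_def prod_eq_iff)
  then have ba: "(b, ?a) \<in> (adj_rel ends ?T')\<^sup>*"
    using reach[OF xy(1)] adj_rtrancl_sym[OF reach[OF \<open>y \<in> ?A\<close>]] by (meson rtrancl_trans)
  have from_b: "(b, z) \<in> (adj_rel ends ?T')\<^sup>*" if "z \<in> V" for z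
    using cover[OF that] reach ba by (metis Un_iff rtrancl_trans)
  then show "connected_on V ends ?T'"
    unfolding connected_on_def by (metis adj_rtrancl_sym rtrancl_trans)
  have "card ?T' = card (T - {h}) + 1" using f finite_tree[OF T] by simp
  also have "\<dots> = card T" using h finite_tree[OF T] by (metis Suc_eq_plus1 card_Suc_Diff1)
  finally show "card ?T' + 1 = card V" using card_tree[OF T] by simp
qed

section \<open>Break divisors with their trees and chip assignments\<close>

definition break_rep :: "'e set \<Rightarrow> ('e \<Rightarrow> 'v) \<Rightarrow> 'v divisor \<Rightarrow> bool" where
  "break_rep T c D \<longleftrightarrow> T \<in> trees \<and> (\<forall>f\<in>E - T. inc f (c f)) \<and>
     D = (\<lambda>u. int (card {f \<in> E - T. c f = u}))"

lemma break_divisors_iff: "D \<in> break_divisors V E ends \<longleftrightarrow> (\<exists>T c. break_rep T c D)"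
  by (auto simp: break_divisors_def break_rep_def)

lemma break_rep_sum:
  "break_rep T c D \<Longrightarrow> finite S \<Longrightarrow> (\<Sum>u\<in>S. D u) = int (card {f \<in> E - T. c f \<in> S})"
  using sum_fibre_card[of "E - T" S c] finite_E unfolding break_rep_def by simp

lemma break_divisor_sum_V:
  assumes "D \<in> break_divisors V E ends"
  shows "(\<Sum>u\<in>V. D u) = int (card E) - int (card V) + 1"
proof -
  obtain T c where r: "break_rep T c D" using assms break_divisors_iff by auto
  then have T: "T \<in> trees" by (simp add: break_rep_def)
  have "{f \<in> E - T. c f \<in> V} = E - T" using r inc_V by (auto simp: break_rep_def)
  moreover have "card (E - T) = card E - card T" "card T \<le> card E"
    using finite_tree[OF T] tree_edges[OF T] finite_E by (auto simp: card_Diff_subset card_mono)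
  ultimately show ?thesis using break_rep_sum[OF r finite_V] card_tree[OF T] by simp
qed

text \<open>Every non-tree edge inside \<open>S\<close> puts its chip in \<open>S\<close>, and at
  most \<open>card S - 1\<close> edges inside \<open>S\<close> belong to the tree.\<close>

lemma break_divisor_sum_ge:
  assumes "D \<in> break_divisors V E ends" "S \<subseteq> V" "S \<noteq> {}"
  shows "(\<Sum>u\<in>S. D u) \<ge> int (card (inside ends E S)) - int (card S) + 1"
proof -
  obtain T c where r: "break_rep T c D" using assms break_divisors_iff by auto
  then have T: "T \<in> trees" by (simp add: break_rep_def)
  have fin: "finite S" using assms(2) finite_V finite_subset by blast
  have "inside ends E S - inside ends T S \<subseteq> {f \<in> E - T. c f \<in> S}"
  proof
    fix f assume f: "f \<in> inside ends E S - inside ends T S"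
    then have "f \<in> E - T" by (auto simp: inside_def)
    moreover from this have "c f = fst (ends f) \<or> c f = snd (ends f)"
      using r by (auto simp: break_rep_def incident_def)
    ultimately show "f \<in> {f \<in> E - T. c f \<in> S}" using f by (auto simp: inside_def)
  qed
  then have "card (inside ends E S - inside ends T S) \<le> card {f \<in> E - T. c f \<in> S}"
    by (rule card_mono[rotated]) (use finite_E in auto)
  moreover have "card (inside ends E S - inside ends T S) \<ge> card (inside ends E S) - card (inside ends T S)"
    by (rule diff_card_le_card_Diff) (use finite_tree[OF T] in \<open>simp add: inside_def\<close>)
  ultimately show ?thesis
    using card_inside_tree[OF T assms(2,3)] break_rep_sum[OF r fin] by linarith
qed

lemma card_inside_split:
  assumes "S \<subseteq> V"
  shows "card E = card (inside ends E S) + card (inside ends E (V - S)) + card {g \<in> E. crosses ends S g}"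
proof -
  have "E = inside ends E S \<union> (inside ends E (V - S) \<union> {g \<in> E. crosses ends S g})"
    using ends_V by (auto simp: inside_def crosses_def)
  then have "card E = card (inside ends E S \<union> (inside ends E (V - S) \<union> {g \<in> E. crosses ends S g}))"
    by simp
  also have "\<dots> = card (inside ends E S) + (card (inside ends E (V - S)) + card {g \<in> E. crosses ends S g})"
    using finite_E
    by (subst card_Un_disjoint; (subst card_Un_disjoint)?) (auto simp: inside_def crosses_def)
  finally show ?thesis by simp
qed

text \<open>If \<open>D - D'\<close> is the Laplacian of \<open>f\<close>, the set where \<open>f\<close> is maximal would carry too many chips
  of \<open>D\<close>, so its complement too few.\<close>

lemma break_divisor_unique:
  assumes D: "D \<in> break_divisors V E ends" "D' \<in> break_divisors V E ends"
    and eq: "lin_equiv E ends D D'"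
  shows "D = D'"
proof -
  obtain f where "(\<lambda>u. D u - D' u) = laplacian E ends f" using eq by (auto simp: lin_equiv_def)
  then have f: "D u - D' u = laplacian E ends f u" for u by metis
  define M where "M = Max (f ` V)"
  define S where "S = {u \<in> V. f u = M}"
  have le: "f u \<le> M" if "u \<in> V" for u using that finite_V by (simp add: M_def)
  have SV: "S \<subseteq> V" by (auto simp: S_def)
  have fin: "finite S" using SV finite_V finite_subset by blast
  have "M \<in> f ` V" using finite_V V_nonempty by (simp add: M_def)
  then have ne: "S \<noteq> {}" by (auto simp: S_def)
  show ?thesis
  proof (cases "S = V")
    case True
    then have "f x = M" if "x \<in> V" for x using that by (auto simp: S_def)
    then have "laplacian E ends f u = 0" for u
      unfolding laplacian_edge_sum using ends_V by (intro sum.neutral) auto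
    then show ?thesis using f by (intro ext) simp
  next
    case False
    let ?S' = "V - S"
    have ne': "?S' \<noteq> {}" using False SV by auto
    \<comment> \<open>As \<open>f\<close> is integer-valued and maximal exactly on \<open>S\<close>,
      it drops by at least 1 along every edge leaving \<open>S\<close>.\<close>
    have "of_bool (crosses ends S g) \<le> (f (fst (ends g)) - f (snd (ends g))) *
       (of_bool (fst (ends g) \<in> S) - of_bool (snd (ends g) \<in> S))" if "g \<in> E" for g
      using le[OF ends_V(1)[OF that]] le[OF ends_V(2)[OF that]] ends_V[OF that]
      by (auto simp: crosses_def S_def)
    then have "(\<Sum>g\<in>E. of_bool (crosses ends S g)) \<le> (\<Sum>u\<in>S. laplacian E ends f u)"
      unfolding laplacian_sum_on[OF fin] by (rule sum_mono)
    then have "int (card {g \<in> E. crosses ends S g}) \<le> (\<Sum>u\<in>S. D u) - (\<Sum>u\<in>S. D' u)"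
      using finite_E by (simp add: int_card_filter f flip: sum_subtractf)
    moreover have "(\<Sum>u\<in>V. D u) = (\<Sum>u\<in>S. D u) + (\<Sum>u\<in>?S'. D u)"
      using sum.subset_diff[OF SV finite_V, of D] by simp
    moreover have "card V = card S + card ?S'"
      using card_Diff_subset[OF fin SV] card_mono[OF finite_V SV] by simp
    \<comment> \<open>The bounds for \<open>D'\<close> on \<open>S\<close> and for \<open>D\<close>
      on \<open>V - S\<close>, together with the crossing edges, force \<open>D\<close> to have
      degree at least \<open>card E - card V + 2\<close>, one more than the genus.\<close>
    ultimately show ?thesis
      using break_divisor_sum_ge[OF D(1) _ ne'] break_divisor_sum_ge[OF D(2) SV ne]
        break_divisor_sum_V[OF D(1)] card_inside_split[OF SV] by simp
  qed
qed

end


context ribbon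
begin

section \<open>Bijectivity of the Bernardi map\<close>

abbreviation "eta \<equiv> bernardi_eta ends rot"
abbreviation "beta \<equiv> bernardi E ends rot"

lemma bernardi_rep:
  "T \<in> trees \<Longrightarrow> (v, e) \<in> flags \<Longrightarrow> break_rep T (eta v e T) (beta v e T)"
  by (auto simp: break_rep_def bernardi_def eta_inc)

lemma bernardi_break: "T \<in> trees \<Longrightarrow> (v, e) \<in> flags \<Longrightarrow> beta v e T \<in> break_divisors V E ends"
  using bernardi_rep break_divisors_iff by blast

text \<open>The first \<open>n\<close> steps consult the tree only at the edges examined in
  them.\<close>

lemma tours_agree:
  assumes "\<And>i. i < n \<Longrightarrow> snd ((step T ^^ i) s) \<in> T \<longleftrightarrow> snd ((step T ^^ i) s) \<in> T'"
  shows "(step T' ^^ n) s = (step T ^^ n) s"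
  using assms by (induction n) (auto simp: tour_step_def Let_def)

text \<open>The vertices beyond \<open>f\<close>, as seen from \<open>v\<close> in the tree containing \<open>f\<close>, carry strictly more
  chips for that tree than for the other one.\<close>

lemma bernardi_first_difference:
  assumes T: "T \<in> trees" "T' \<in> trees" and s: "(v, e) \<in> flags"
    and agree: "\<And>i. i < n \<Longrightarrow>
      snd ((step T ^^ i) (v, e)) \<in> T \<longleftrightarrow> snd ((step T ^^ i) (v, e)) \<in> T'"
    and f: "snd ((step T ^^ n) (v, e)) = f" "f \<in> T'" "f \<notin> T"
  shows "beta v e T \<noteq> beta v e T'"
proof -
  let ?s = "(v, e)"
  let ?p = "pos (step T) ?s" and ?p' = "pos (step T') ?s"
  note cyc = cyclic_tour[OF T(1)] cyclic_tour[OF T(2)]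
  have same: "(step T' ^^ i) ?s = (step T ^^ i) ?s" if "i \<le> n" for i
    using that agree by (intro tours_agree) auto
  \<comment> \<open>The edges examined before time \<open>n\<close>. On these the trees agree, and
    both tours examine them in the same way.\<close>
  define W where "W = (\<lambda>i. snd ((step T ^^ i) ?s)) ` {..<n}"
  have W_agree: "g \<in> T \<longleftrightarrow> g \<in> T'" if "g \<in> W" for g using that agree by (auto simp: W_def)
  then have fW: "f \<notin> W" using f by auto
  have early: "g \<in> W" if "(x, g) \<in> flags" "?p (x, g) < n \<or> ?p' (x, g) < n" for x g
  proof -
    define i where "i = (if ?p (x, g) < n then ?p (x, g) else ?p' (x, g))"
    have "i < n" using that(2) by (auto simp: i_def)
    moreover have "(step T ^^ i) ?s = (x, g)"
      using funpow_pos[OF cyc(1) s that(1)] funpow_pos[OF cyc(2) s that(1)] same[of i] \<open>i < n\<close>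
      by (simp add: i_def split: if_splits)
    ultimately show ?thesis unfolding W_def by force
  qed
  define u where "u = fst ((step T ^^ n) ?s)"
  have at_n: "(step T ^^ n) ?s = (u, f)" "(step T' ^^ n) ?s = (u, f)"
    by (simp_all only: same[OF order.refl] prod_eq_iff u_def f(1) fst_conv snd_conv simp_thms)
  then have uf: "(u, f) \<in> flags" using funpow_step_flags[OF s] by metis
  then have fE: "f \<in> E" "inc f u" by (auto simp: flags_iff)
  define w where "w = opp f u"
  have w: "inc f w" "opp f w = u" "w \<noteq> u"
    using inc_opp[OF fE] opp_opp[OF fE] opp_neq[OF fE] by (auto simp: w_def)
  have wf: "(w, f) \<in> flags" using w fE by (simp add: flags_iff)
  have pn: "?p (u, f) = n" "?p' (u, f) = n"
    using pos_le[OF at_n(1)] pos_le[OF at_n(2)] early[OF uf] fW by (auto intro: antisym leI)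
  define S where "S = comp_of ends (T' - {f}) w"
  have S: "w \<in> S" "u \<notin> S" and cut: "cut_by T' S f"
    using tree_cut[OF T(2) f(2) w(1)] w(2) by (auto simp: S_def)
  have SV: "S \<subseteq> V" using cut by (simp add: cut_by_def)
  have uV: "u \<in> V" using inc_V[OF fE] .
  \<comment> \<open>From a start in \<open>S\<close> the tour of \<open>T'\<close> could reach
    \<open>u\<close> only by walking along \<open>f\<close> from \<open>w\<close>, so
    \<open>f\<close> would have been examined before time \<open>n\<close>.\<close>
  have vS: "v \<notin> S"
  proof
    assume "v \<in> S"
    then have "?p' (w, f) < ?p' (u, f)"
      using visit_interval[OF T(2) s cut_by_compl[OF tree_edges[OF T(2)] cut] f(2) fE(2) _ _ uf]
        S uV by (simp add: w_def)
    then show False using early[OF wf] fW pn by auto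
  qed
  have in_S: "x \<in> S \<longleftrightarrow> n < ?p' (x, g) \<and> ?p' (x, g) \<le> ?p' (w, f)" if "(x, g) \<in> flags" for x g
    using visit_interval[OF T(2) s cut f(2) w(1) S(1) _ that] vS w(2) pn by simp
  \<comment> \<open>Besides the edges in \<open>I\<close>, only the late crossing edges in
    \<open>M\<close> can matter: all of \<open>M\<close> and all of \<open>I\<close> off
    \<open>T'\<close> give chips to \<open>S\<close> for \<open>T'\<close>, whereas for
    \<open>T\<close> only edges of \<open>I \<union> M\<close> off \<open>T\<close> can.\<close>
  define I where "I = inside ends E S"
  define M where "M = {g \<in> E. crosses ends S g \<and> g \<notin> W \<and> g \<noteq> f}"
  have IM: "finite I" "finite M" "I \<inter> M = {}"
    using finite_E by (auto simp: I_def M_def inside_def crosses_def)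
  \<comment> \<open>The tour of \<open>T'\<close> spends one block in \<open>S\<close> right after
    time \<open>n\<close>, so it meets a late crossing edge first from its end in
    \<open>S\<close>.\<close>
  have late: "eta v e T' g \<in> S" if g: "g \<in> E - T'" "crosses ends S g" "g \<notin> W" for g
  proof -
    obtain x where x: "x \<in> S" "opp g x \<notin> S" "inc g x"
      using g(2) by (auto simp: crosses_def incident_def other_end_def) (metis no_loop g(1) DiffD1)+
    have fl: "(x, g) \<in> flags" "(opp g x, g) \<in> flags"
      using g(1) x inc_opp[of g x] by (auto simp: flags_iff)
    have "?p' (opp g x, g) \<noteq> n"
      using pos_inj[OF cyc(2) s fl(2) uf] pn g(1) f(2) by auto
    moreover have "\<not> ?p' (opp g x, g) < n" using early[OF fl(2)] g(3) by auto
    ultimately have "?p' (x, g) < ?p' (opp g x, g)"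
      using in_S[OF fl(1)] in_S[OF fl(2)] x by auto
    then show ?thesis using eta_eq[OF T(2) s _ x(3)] g(1) x by auto
  qed
  \<comment> \<open>Before time \<open>n\<close> the tours agree and have not entered
    \<open>S\<close>, so crossing edges examined then are first cut from outside; \<open>f\<close>
    is first cut from \<open>u\<close>, also outside.\<close>
  have early_S: "g \<in> I \<union> M" if g: "g \<in> E - T" "eta v e T g \<in> S" for g
  proof (cases "crosses ends S g")
    case False
    then show ?thesis using g eta_inc[OF T(1) s, of g]
      by (auto simp: I_def inside_def crosses_def incident_def)
  next
    case True
    define x where "x = eta v e T g"
    have gE: "g \<in> E" "inc g x" using g eta_inc[OF T(1) s, of g] by (auto simp: x_def)
    have x: "x \<in> S" "opp g x \<notin> S"
      using True g(2) crosses_iff[OF gE, of S] by (auto simp: x_def)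
    have fl: "(x, g) \<in> flags" "(opp g x, g) \<in> flags"
      using gE inc_opp[OF gE] by (auto simp: flags_iff)
    have "x \<noteq> opp g x" using opp_neq[OF gE] by simp
    then have lt: "?p (x, g) < ?p (opp g x, g)"
      using eta_eq[OF T(1) s gE, folded x_def] by metis
    have "\<not> ?p (x, g) < n"
    proof
      assume "?p (x, g) < n"
      then have "(step T' ^^ ?p (x, g)) ?s = (x, g)"
        using same funpow_pos[OF cyc(1) s fl(1)] by simp
      then have "?p' (x, g) \<le> ?p (x, g)" by (rule pos_le)
      then have "?p' (x, g) < n" using \<open>?p (x, g) < n\<close> by simp
      then show False using in_S[OF fl(1)] x(1) by simp
    qed
    have "g \<notin> W"
    proof
      assume "g \<in> W"
      then obtain i where i: "i < n" "snd ((step T ^^ i) ?s) = g" unfolding W_def by blast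
      define z where "z = fst ((step T ^^ i) ?s)"
      have z: "(step T ^^ i) ?s = (z, g)" by (simp only: i z_def prod_eq_iff fst_conv snd_conv simp_thms)
      then have "(z, g) \<in> flags" using funpow_step_flags[OF s] by metis
      then have "z = x \<or> z = opp g x" using inc_cases[OF gE] by (auto simp: flags_iff)
      then show False using pos_le[OF z] i(1) lt \<open>\<not> ?p (x, g) < n\<close> by auto
    qed
    moreover have "g \<noteq> f"
    proof
      assume "g = f"
      then have "opp g x = u" using x S inc_cases[OF fE] gE w w_def by auto
      then show False using lt pn \<open>\<not> ?p (x, g) < n\<close> \<open>g = f\<close> by simp
    qed
    ultimately show ?thesis using gE True by (simp add: M_def)
  qed
  have fin: "finite S" using SV finite_V finite_subset by blast
  \<comment> \<open>The edges of \<open>T\<close> that meet \<open>S\<close>. Those that cross are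
    late, because on \<open>W\<close> the trees agree and \<open>T'\<close> crosses the cut only in
    \<open>f\<close>.\<close>
  have sub: "T - inside ends T (V - S) \<subseteq> I \<union> M"
  proof
    fix g assume g: "g \<in> T - inside ends T (V - S)"
    then have gE: "g \<in> E" using tree_edges[OF T(1)] by auto
    have "g \<notin> W" "g \<noteq> f" if "crosses ends S g"
      using that g W_agree[of g] cut fW f(3) by (auto simp: cut_by_def)
    then show "g \<in> I \<union> M"
      using g gE ends_V[OF gE] by (auto simp: I_def M_def inside_def crosses_def)
  qed
  have "(I - inside ends T' S) \<union> M \<subseteq> {g \<in> E - T'. eta v e T' g \<in> S}"
  proof
    fix g assume "g \<in> (I - inside ends T' S) \<union> M"
    then consider "g \<in> I" "g \<notin> T'" | "g \<in> M" by (auto simp: I_def inside_def)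
    then show "g \<in> {g \<in> E - T'. eta v e T' g \<in> S}"
    proof cases
      case 1
      then show ?thesis using eta_inc[OF T(2) s, of g] by (auto simp: I_def inside_def incident_def)
    next
      case 2
      then have "g \<in> E - T'" using cut by (auto simp: M_def cut_by_def)
      then show ?thesis using late 2 by (auto simp: M_def)
    qed
  qed
  then have "card ((I - inside ends T' S) \<union> M) \<le> card {g \<in> E - T'. eta v e T' g \<in> S}"
    by (rule card_mono[rotated]) (use finite_E in auto)
  moreover have "card ((I - inside ends T' S) \<union> M) = card (I - inside ends T' S) + card M"
    using IM by (intro card_Un_disjoint) auto
  moreover have "card (I - inside ends T' S) \<ge> card I - card (inside ends T' S)"
    by (rule diff_card_le_card_Diff) (use finite_tree[OF T(2)] in \<open>simp add: inside_def\<close>)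
  moreover have "card (inside ends T' S) + 1 \<le> card S"
    using card_inside_tree[OF T(2) SV] S by auto
  moreover have "card {g \<in> E - T. eta v e T g \<in> S} \<le> card ((I \<union> M) - (T - inside ends T (V - S)))"
    by (rule card_mono) (use IM early_S in auto)
  moreover have "card ((I \<union> M) - (T - inside ends T (V - S))) =
      card (I \<union> M) - card (T - inside ends T (V - S))"
    by (rule card_Diff_subset[OF _ sub]) (use finite_tree[OF T(1)] in simp)
  moreover have "card (I \<union> M) = card I + card M"
    using IM by (intro card_Un_disjoint) auto
  moreover have "card (T - inside ends T (V - S)) = card T - card (inside ends T (V - S))"
    by (rule card_Diff_subset) (use finite_tree[OF T(1)] in \<open>auto simp: inside_def\<close>)
  moreover have "card (inside ends T (V - S)) + 1 \<le> card (V - S)"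
    using card_inside_tree[OF T(1), of "V - S"] uV S by auto
  moreover have "card V = card S + card (V - S)"
    using card_Diff_subset[OF fin SV] card_mono[OF finite_V SV] by simp
  moreover have "card (T - inside ends T (V - S)) \<le> card (I \<union> M)"
    by (rule card_mono[OF _ sub]) (use IM in simp)
  \<comment> \<open>At least \<open>card S\<close> edges of \<open>T\<close> meet \<open>S\<close>,
    but at most \<open>card S - 1\<close> edges of \<open>T'\<close> lie inside it, so
    \<open>T\<close> places at most \<open>card I + card M - card S\<close> chips in
    \<open>S\<close> and \<open>T'\<close> at least one more.\<close>
  ultimately have "card {g \<in> E - T. eta v e T g \<in> S} < card {g \<in> E - T'. eta v e T' g \<in> S}"
    using card_tree[OF T(1)] by linarith
  then have "(\<Sum>u\<in>S. beta v e T u) \<noteq> (\<Sum>u\<in>S. beta v e T' u)"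
    using break_rep_sum[OF bernardi_rep[OF T(1) s] fin] break_rep_sum[OF bernardi_rep[OF T(2) s] fin]
    by simp
  then show ?thesis by auto
qed

lemma tour_visits_all:
  assumes "T \<in> trees" "(v, e) \<in> flags" "g \<in> E"
  shows "\<exists>n. snd ((step T ^^ n) (v, e)) = g"
proof -
  have "(fst (ends g), g) \<in> flags" using assms(3) by (simp add: flags_iff incident_def)
  from funpow_pos[OF cyclic_tour[OF assms(1)] assms(2) this] show ?thesis by (metis snd_conv)
qed

text \<open>Since the tours visit every edge, there is a first examined edge on which the trees
  differ. Up to it the tours coincide, so the comparison applies with the trees in either
  order.\<close>

lemma bernardi_inj:
  assumes s: "(v, e) \<in> flags"
  shows "inj_on (beta v e) trees"
proof (rule inj_onI, rule ccontr)
  fix T T' assume T: "T \<in> trees" "T' \<in> trees" and eq: "beta v e T = beta v e T'" and ne: "T \<noteq> T'"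
  let ?f = "\<lambda>n. snd ((step T ^^ n) (v, e))"
  define P where "P n \<longleftrightarrow> (?f n \<in> T) \<noteq> (?f n \<in> T')" for n
  obtain g where "g \<in> E" "(g \<in> T) \<noteq> (g \<in> T')" using ne tree_edges[OF T(1)] tree_edges[OF T(2)] by blast
  then obtain n0 where "P n0" using tour_visits_all[OF T(1) s] unfolding P_def by blast
  define n where "n = (LEAST n. P n)"
  have "P n" unfolding n_def by (rule LeastI[of P, OF \<open>P n0\<close>])
  have "\<not> P i" if "i < n" for i using that unfolding n_def by (rule not_less_Least)
  then have agree: "?f i \<in> T \<longleftrightarrow> ?f i \<in> T'" if "i < n" for i using that unfolding P_def by blast
  have same: "(step T' ^^ i) (v, e) = (step T ^^ i) (v, e)" if "i \<le> n" for i
    using that agree by (intro tours_agree) auto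
  consider "?f n \<in> T'" "?f n \<notin> T" | "?f n \<in> T" "?f n \<notin> T'"
    using \<open>P n\<close> unfolding P_def by blast
  then show False
  proof cases
    case 1
    then show ?thesis using bernardi_first_difference[OF T s agree refl] eq by blast
  next
    case 2
    have "beta v e T' \<noteq> beta v e T"
      by (rule bernardi_first_difference[OF T(2,1) s, of n "?f n"]) (use agree same 2 in auto)
    then show ?thesis using eq by simp
  qed
qed

section \<open>Surjectivity by a minimal representation\<close>

text \<open>Ordering the representations of a break divisor by their words of digits makes the
  representation coming from the Bernardi map the smallest one; the digit 2 marks a disagreement.\<close>

definition digit :: "'v \<Rightarrow> 'e \<Rightarrow> 'e set \<Rightarrow> ('e \<Rightarrow> 'v) \<Rightarrow> nat \<Rightarrow> nat" where
  "digit v e T c n = (let u = fst ((step T ^^ n) (v, e)); f = snd ((step T ^^ n) (v, e)) in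
     if f \<in> T then 1
     else if (\<forall>j<n. snd ((step T ^^ j) (v, e)) \<noteq> f) \<and> c f \<noteq> u then 2 else 0)"

definition word :: "'v \<Rightarrow> 'e \<Rightarrow> 'e set \<times> ('e \<Rightarrow> 'v) \<Rightarrow> nat list" where
  "word v e = (\<lambda>(T, c). map (digit v e T c) [0..<card flags])"

lemma digit_agree:
  assumes agree: "\<And>i. i < k \<Longrightarrow> snd ((step T ^^ i) (v, e)) \<in> T \<longleftrightarrow> snd ((step T ^^ i) (v, e)) \<in> T'"
    and c: "\<And>i. i < k \<Longrightarrow> c' (snd ((step T ^^ i) (v, e))) = c (snd ((step T ^^ i) (v, e)))"
    and i: "i < k"
  shows "digit v e T' c' i = digit v e T c i"
proof -
  have "(step T' ^^ j) (v, e) = (step T ^^ j) (v, e)" if "j \<le> i" for j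
    using that i agree by (intro tours_agree) auto
  then show ?thesis using agree[OF i] c[OF i] by (simp add: digit_def Let_def)
qed

text \<open>The chip of \<open>f\<close> is handed over to \<open>h\<close> and stays at the vertex
  \<open>c f\<close>, which is an end of both edges, so the divisor does not change.\<close>

lemma break_rep_exchange:
  assumes r: "break_rep T c D" and f: "f \<in> E - T" and h: "h \<in> T" "inc h (c f)"
    and cr: "crosses ends (comp_of ends (T - {h}) (c f)) f"
  shows "break_rep (insert f (T - {h})) (c(h := c f)) D"
proof -
  let ?T' = "insert f (T - {h})" and ?c' = "c(h := c f)"
  have T: "T \<in> trees" using r by (simp add: break_rep_def)
  have hE: "h \<in> E" using h tree_edges[OF T] by auto
  have T': "?T' \<in> trees" using tree_exchange[OF T h _ _ cr] f by auto
  have hf: "h \<noteq> f" using f h by auto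
  have same_card: "card {g \<in> E - ?T'. ?c' g = x} = card {g \<in> E - T. c g = x}" for x
  proof -
    let ?A = "{g \<in> E - T. c g = x}" and ?A' = "{g \<in> E - ?T'. ?c' g = x}"
    have fin: "finite ?A" using finite_E by simp
    have "h \<notin> ?A" using h by simp
    show ?thesis
    proof (cases "x = c f")
      case True
      then have "f \<in> ?A" "?A' = insert h (?A - {f})" using f h(1) hE hf by auto
      then show ?thesis using fin \<open>h \<notin> ?A\<close> by (simp only: card_insert_disjoint
          finite_Diff card_Suc_Diff1 Diff_iff simp_thms)
    next
      case False
      then have "?A' = ?A" using f h(1) by auto
      then show ?thesis by (simp only:)
    qed
  qed
  have "inc g (?c' g)" if "g \<in> E - ?T'" for g
    using that r h(2) unfolding break_rep_def by (cases "g = h") auto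
  moreover have "D = (\<lambda>u. int (card {f \<in> E - T. c f = u}))" using r by (simp only: break_rep_def)
  then have "D = (\<lambda>u. int (card {g \<in> E - ?T'. ?c' g = u}))" by (simp only: same_card)
  ultimately show ?thesis using T' unfolding break_rep_def by blast
qed

lemma bernardi_surj:
  assumes s: "(v, e) \<in> flags" and D: "D \<in> break_divisors V E ends"
  shows "\<exists>T\<in>trees. beta v e T = D"
proof -
  let ?s = "(v, e)"
  let ?R = "{(T, c). break_rep T c D}"
  have wf: "wf (inv_image (lex less_than) (word v e))" by (intro wf_inv_image wf_lex wf_less_than)
  obtain T0 c0 where "(T0, c0) \<in> ?R" using D break_divisors_iff by auto
  from wfE_min[OF wf this] obtain m where m: "m \<in> ?R"
    "\<And>m'. (m', m) \<in> inv_image (lex less_than) (word v e) \<Longrightarrow> m' \<notin> ?R" by blast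
  obtain T c where Tc: "m = (T, c)" by fastforce
  have r: "break_rep T c D" using m(1) Tc by simp
  have minimal: False if r': "break_rep T' c' D" and k: "k < card flags" and
    less: "digit v e T' c' k < digit v e T c k" and
    same: "\<And>i. i < k \<Longrightarrow> digit v e T' c' i = digit v e T c i" for T' c' k
    using m(2)[of "(T', c')"] r' map_upt_lex[of k "card flags" "digit v e T' c'" "digit v e T c", OF k same less] by (simp add: Tc word_def)
  have T: "T \<in> trees" using r by (simp add: break_rep_def)
  note cyc = cyclic_tour[OF T]
  let ?p = "pos (step T) ?s" and ?f = "\<lambda>n. snd ((step T ^^ n) ?s)"
  have "c f = eta v e T f" if f: "f \<in> E - T" for f
  proof (rule ccontr)
    assume bad: "c f \<noteq> eta v e T f"
    define u where "u = eta v e T f"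
    define w where "w = c f"
    have fE: "f \<in> E" "inc f u" using f eta_inc[OF T s] by (auto simp: u_def)
    have wf: "inc f w" using r f by (auto simp: break_rep_def w_def)
    then have w: "w = opp f u" "w \<noteq> u" using bad inc_cases[OF fE] by (auto simp: u_def w_def)
    have fl: "(u, f) \<in> flags" "(w, f) \<in> flags" using fE wf by (auto simp: flags_iff)
    define n where "n = ?p (u, f)"
    have at_n: "(step T ^^ n) ?s = (u, f)" unfolding n_def by (rule funpow_pos[OF cyc s fl(1)])
    have nN: "n < card flags" unfolding n_def by (rule pos_less[OF cyc s fl(1)])
    have n_lt: "n < ?p (w, f)"
    proof -
      have "?p (u, f) \<noteq> ?p (w, f)" using pos_inj[OF cyc s fl] w(2) by auto
      then show ?thesis
        using eta_eq[OF T s fE, folded u_def] w unfolding n_def by metis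
    qed
    have first_at: "i \<ge> n" if "?f i = f" for i
    proof -
      define z where "z = fst ((step T ^^ i) ?s)"
      have z: "(step T ^^ i) ?s = (z, f)" by (simp only: that z_def prod_eq_iff fst_conv snd_conv simp_thms)
      then have "(z, f) \<in> flags" using funpow_step_flags[OF s] by metis
      then have "z = u \<or> z = w" using inc_cases[OF fE] w by (auto simp: flags_iff)
      then show ?thesis using pos_le[OF z] n_lt by (auto simp: n_def)
    qed
    have digit_n: "digit v e T c n = 2"
      using at_n f first_at w by (auto simp: digit_def Let_def w_def not_le dest!: leD)
    have "(u, w) \<in> (adj_rel ends T)\<^sup>*"
      using tree_connected[OF T] inc_V[OF fE] inc_V[OF fE(1) wf] by (auto simp: connected_on_def)
    \<comment> \<open>\<open>h\<close> is the edge at \<open>w\<close> on the tree path towards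
      \<open>u\<close>. It can be exchanged for \<open>f\<close> and take over the chip at
      \<open>w\<close>.\<close>
    from first_separating_edge[OF tree_acyclic[OF T] this] w(2)
    obtain h where h: "h \<in> T" "inc h w" "(w, u) \<notin> (adj_rel ends (T - {h}))\<^sup>*" by auto
    define S where "S = comp_of ends (T - {h}) w"
    have S: "w \<in> S" "opp h w \<notin> S" and cut: "cut_by T S h"
      using tree_cut[OF T h(1,2)] by (auto simp: S_def)
    have uS: "u \<notin> S" using h(3) by (simp add: S_def comp_of_def)
    have hE: "h \<in> E" using h tree_edges[OF T] by auto
    have cr: "crosses ends S f" using crosses_iff[OF fE, of S] uS S(1) w(1) by simp
    let ?T' = "insert f (T - {h})" and ?c' = "c(h := w)"
    have r': "break_rep ?T' ?c' D"
      using break_rep_exchange[OF r f h(1)] h(2) cr by (simp add: w_def S_def)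
    have agree: "(?f i \<in> T \<longleftrightarrow> ?f i \<in> ?T') \<and> ?c' (?f i) = c (?f i)"
      if "i < k" "k \<le> n" "\<And>j. j < k \<Longrightarrow> ?f j \<noteq> h" for i k
      using that first_at[of i] by fastforce
    have same_tour: "(step ?T' ^^ k) ?s = (step T ^^ k) ?s"
      if "k \<le> n" "\<And>j. j < k \<Longrightarrow> ?f j \<noteq> h" for k
      by (rule tours_agree) (use agree that in blast)
    have same: "digit v e ?T' ?c' i = digit v e T c i"
      if "i < k" "k \<le> n" "\<And>j. j < k \<Longrightarrow> ?f j \<noteq> h" for i k
      by (rule digit_agree[of k]) (use agree that in blast)+
    show False
    proof (cases "\<exists>i<n. ?f i = h")
      case False
      then have none: "?f i \<noteq> h" if "i < n" for i using that by auto
      \<comment> \<open>If \<open>h\<close> is not examined before \<open>f\<close>, the word first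
        changes at \<open>n\<close>, where \<open>f\<close> becomes a tree edge and 2 drops to
        1.\<close>
      have "digit v e ?T' ?c' n = 1"
        using same_tour[OF order.refl none] at_n by (simp add: digit_def Let_def)
      then show ?thesis
        using minimal[OF r' nN] digit_n same[OF _ order.refl none] by simp
    next
      case True
      then obtain i0 where i0: "i0 < n" "?f i0 = h" by auto
      \<comment> \<open>Otherwise the word first changes where \<open>h\<close> is first examined.
        If this happens from \<open>w\<close>, the new chip of \<open>h\<close> lies at the right
        end and 1 drops to 0.\<close>
      define k where "k = (LEAST i. ?f i = h)"
      have fk: "?f k = h" unfolding k_def by (rule LeastI[of _ i0]) (rule i0)
      have kn: "k < n" using i0 Least_le[of "\<lambda>i. ?f i = h" i0] unfolding k_def by linarith
      have none: "?f i \<noteq> h" if "i < k" for i using that not_less_Least unfolding k_def by blast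
      define z where "z = fst ((step T ^^ k) ?s)"
      have at_k: "(step T ^^ k) ?s = (z, h)" using fk by (simp only: fk z_def prod_eq_iff fst_conv snd_conv simp_thms)
      then have zfl: "(z, h) \<in> flags" using funpow_step_flags[OF s] by metis
      have hfl: "(w, h) \<in> flags" "(opp h w, h) \<in> flags"
        using hE h(2) inc_opp[OF hE h(2)] by (auto simp: flags_iff)
      have h_first: "k \<le> ?p (x, h)" if "(x, h) \<in> flags" for x
        using funpow_pos[OF cyc s that] none[of "?p (x, h)"] by (auto intro: leI)
      have pz: "?p (z, h) = k" using pos_le[OF at_k] h_first[OF zfl] by simp
      \<comment> \<open>Otherwise the tour enters \<open>S\<close> along \<open>h\<close> at time
        \<open>k\<close>. As \<open>(w, f)\<close> lies in \<open>S\<close> and comes after time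
        \<open>n\<close>, time \<open>n\<close> falls into the same block, although \<open>u\<close>
        is outside \<open>S\<close>.\<close>
      have "z = w"
      proof (rule ccontr)
        assume "z \<noteq> w"
        then have z: "z = opp h w" using inc_cases[OF hE h(2)] zfl by (auto simp: flags_iff)
        note oo = opp_opp[OF hE h(2)]
        have "v \<notin> S"
        proof
          assume "v \<in> S"
          then have "?p (w, h) < ?p (opp h w, h)"
            using visit_interval[OF T s cut_by_compl[OF tree_edges[OF T] cut] h(1)
                inc_opp[OF hE h(2)] _ _ hfl(2)] S oo flags_V[OF hfl(2)] by simp
          then show False using h_first[OF hfl(1)] pz z by simp
        qed
        then have "x \<in> S \<longleftrightarrow> k < ?p (x, g) \<and> ?p (x, g) \<le> ?p (w, h)" if "(x, g) \<in> flags" for x g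
          using visit_interval[OF T s cut h(1,2) S(1) _ that] pz z by simp
        from this[OF fl(1)] this[OF fl(2)] show False
          using S(1) uS kn n_lt by (simp add: n_def)
      qed
      then have "(step ?T' ^^ k) ?s = (w, h)" using same_tour[of k] none kn at_k by simp
      moreover have "h \<notin> ?T'" using h(1) f by auto
      ultimately have "digit v e ?T' ?c' k = 0" by (simp add: digit_def Let_def)
      moreover have "digit v e T c k = 1" using at_k h(1) by (simp add: digit_def Let_def)
      ultimately show ?thesis
        using minimal[OF r', of k] kn nN same[of _ k] none by simp
    qed
  qed
  then have "{f \<in> E - T. eta v e T f = x} = {f \<in> E - T. c f = x}" for x by auto
  then have "beta v e T = D" using r unfolding break_rep_def bernardi_def by auto
  then show ?thesis using T by blast
qed

end


context ribbon
begin

section \<open>Changing the initial edge\<close>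

definition chip :: "'v \<Rightarrow> 'v divisor" where
  "chip x = (\<lambda>u. of_bool (x = u))"

text \<open>The tours starting with \<open>e\<close> and with the edge after \<open>e\<close> differ by moving an initial segment
  to the end. This segment consists of \<open>(v, e)\<close> alone or, if \<open>e\<close> is a tree edge, of \<open>(v, e)\<close> and
  all flags on the far side of \<open>e\<close>.\<close>

lemma rotation_segment:
  assumes T: "T \<in> trees" and s: "(v, e) \<in> flags"
  shows "\<exists>k S. (step T ^^ k) (v, e) = (v, rot v e) \<and> k \<le> card flags \<and>
    (\<forall>x g. (x, g) \<in> flags \<longrightarrow> (pos (step T) (v, e) (x, g) < k \<longleftrightarrow> (x, g) = (v, e) \<or> x \<in> S)) \<and>
    (\<forall>g\<in>T. g \<noteq> e \<longrightarrow> \<not> crosses ends S g) \<and> v \<notin> S \<and> (e \<in> T \<longleftrightarrow> opp e v \<in> S) \<and>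
    (e \<notin> T \<longrightarrow> S = {})"
proof -
  let ?p = "pos (step T) (v, e)"
  note cyc = cyclic_tour[OF T]
  have e: "e \<in> E" "inc e v" using s by (auto simp: flags_iff)
  have p0: "?p (v, e) = 0" using pos_le[of 0 "step T" "(v, e)" "(v, e)"] by simp
  have zero: "?p (x, g) = 0 \<longleftrightarrow> (x, g) = (v, e)" if "(x, g) \<in> flags" for x g
    using pos_inj[OF cyc s that s] p0 by auto
  show ?thesis
  proof (cases "e \<in> T")
    case False
    have "1 \<le> card flags" using s finite_flags by (metis One_nat_def Suc_leI card_gt_0_iff empty_iff)
    then show ?thesis using False s zero
      by (intro exI[of _ 1] exI[of _ "{}"]) (auto simp: step_eq crosses_def)
  next
    case True
    let ?w = "opp e v"
    define S where "S = comp_of ends (T - {e}) ?w"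
    have w: "inc e ?w" "opp e ?w = v" using inc_opp[OF e] opp_opp[OF e] by auto
    have S: "?w \<in> S" "v \<notin> S" and cut: "cut_by T S e"
      using tree_cut[OF T True w(1)] w(2) by (auto simp: S_def)
    have wfl: "(?w, e) \<in> flags" using w e by (simp add: flags_iff)
    \<comment> \<open>One step after the far side is left along \<open>e\<close>, when the tour is
      back at \<open>v\<close>.\<close>
    define k where "k = Suc (?p (?w, e))"
    have "(step T ^^ k) (v, e) = (v, rot v e)"
      using funpow_pos[OF cyc s wfl] True w(2) by (simp add: k_def step_eq)
    moreover have "k \<le> card flags" using pos_less[OF cyc s wfl] by (simp add: k_def)
    moreover have "?p (x, g) < k \<longleftrightarrow> (x, g) = (v, e) \<or> x \<in> S" if "(x, g) \<in> flags" for x g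
      using visit_interval[OF T s cut True w(1) S(1) _ that] S(2) w(2) p0 zero[OF that]
      by (auto simp: k_def)
    moreover have "\<forall>g\<in>T. g \<noteq> e \<longrightarrow> \<not> crosses ends S g" using cut by (auto simp: cut_by_def)
    ultimately show ?thesis using S True by (intro exI[of _ k] exI[of _ S]) blast
  qed
qed

text \<open>Moving an initial segment to the end reverses the order of the two flags of an edge
  exactly when one of them lies in the segment.\<close>

lemma eta_shift:
  assumes T: "T \<in> trees" and s: "(v, e) \<in> flags"
    and k: "(step T ^^ k) (v, e) = (v, e')" "k \<le> card flags" and g: "g \<in> E" "inc g x"
  defines "p \<equiv> pos (step T) (v, e)"
  shows "(p (x, g) < k \<longleftrightarrow> p (opp g x, g) < k) \<Longrightarrow> eta v e' T g = eta v e T g"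
    and "p (x, g) < k \<Longrightarrow> \<not> p (opp g x, g) < k \<Longrightarrow> eta v e T g = x \<and> eta v e' T g = opp g x"
proof -
  note cyc = cyclic_tour[OF T]
  have s': "(v, e') \<in> flags" using funpow_step_flags[OF s, of k T] k(1) by simp
  have fl: "(x, g) \<in> flags" "(opp g x, g) \<in> flags" using g inc_opp[OF g] by (auto simp: flags_iff)
  note shift = pos_shift[OF cyc s fl(1) k, folded p_def] pos_shift[OF cyc s fl(2) k, folded p_def]
  have lt: "p (x, g) < card flags" "p (opp g x, g) < card flags"
    using pos_less[OF cyc s] fl by (auto simp: p_def)
  note eta = eta_eq[OF T s g, folded p_def] eta_eq[OF T s' g]
  show "eta v e' T g = eta v e T g" if "p (x, g) < k \<longleftrightarrow> p (opp g x, g) < k"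
  proof -
    have "pos (step T) (v, e') (x, g) < pos (step T) (v, e') (opp g x, g) \<longleftrightarrow>
      p (x, g) < p (opp g x, g)"
      unfolding shift using that lt k(2) by auto
    then show ?thesis unfolding eta by simp
  qed
  show "eta v e T g = x \<and> eta v e' T g = opp g x" if "p (x, g) < k" "\<not> p (opp g x, g) < k"
  proof -
    have "p (x, g) < p (opp g x, g)" using that by simp
    moreover have "\<not> pos (step T) (v, e') (x, g) < pos (step T) (v, e') (opp g x, g)"
      unfolding shift using that lt k(2) by auto
    ultimately show ?thesis unfolding eta by simp
  qed
qed

lemma bernardi_eq_sum:
  "T \<subseteq> E \<Longrightarrow> beta v e T u = (\<Sum>g\<in>E. of_bool (g \<notin> T) * of_bool (eta v e T g = u))"
proof -
  assume "T \<subseteq> E"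
  have "beta v e T u = int (card {g \<in> E. g \<notin> T \<and> eta v e T g = u})"
    by (simp add: bernardi_def)
  also have "\<dots> = (\<Sum>g\<in>E. of_bool (g \<notin> T \<and> eta v e T g = u))"
    by (rule int_card_filter[OF finite_E])
  finally show ?thesis by (simp add: of_bool_conj)
qed

text \<open>Non-tree edges other than \<open>e\<close> that cross \<open>S\<close> have one flag in
  the moved segment and shift their chips out of \<open>S\<close>. This is the Laplacian of
  \<open>f\<close> away from \<open>e\<close>.\<close>

lemma bernardi_rot:
  assumes T: "T \<in> trees" and s: "(v, e) \<in> flags"
  shows "lin_equiv E ends (beta v (rot v e) T)
    (\<lambda>u. beta v e T u + (chip (opp e v) u - chip v u))"
proof -
  let ?p = "pos (step T) (v, e)" and ?e' = "rot v e"
  let ?w = "opp e v"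
  have e: "e \<in> E" "inc e v" using s by (auto simp: flags_iff)
  obtain k S where k: "(step T ^^ k) (v, e) = (v, ?e')" "k \<le> card flags"
    and seg: "\<And>x g. (x, g) \<in> flags \<Longrightarrow> ?p (x, g) < k \<longleftrightarrow> (x, g) = (v, e) \<or> x \<in> S"
    and nc: "\<And>g. g \<in> T \<Longrightarrow> g \<noteq> e \<Longrightarrow> \<not> crosses ends S g"
    and S: "v \<notin> S" "e \<in> T \<longleftrightarrow> ?w \<in> S" "e \<notin> T \<Longrightarrow> S = {}"
    using rotation_segment[OF T s] by blast
  \<comment> \<open>The indicator of the complement: its Laplacian moves one chip out of
    \<open>S\<close> along each crossing edge.\<close>
  define f :: "'v \<Rightarrow> int" where "f x = of_bool (x \<notin> S)" for x
  define d where "d u g = (f (fst (ends g)) - f (snd (ends g))) *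
      (of_bool (fst (ends g) = u) - of_bool (snd (ends g) = u))" for u g
  have d: "d u g = (f x - f (opp g x)) * (of_bool (x = u) - of_bool (opp g x = u))"
    if "g \<in> E" "inc g x" for u g x
    using that no_loop[of g] by (auto simp: d_def incident_def other_end_def)
  have shift: "eta v ?e' T g = eta v e T g" if "g \<in> E" "g \<noteq> e" "\<not> crosses ends S g" for g
  proof -
    have i: "inc g (fst (ends g))" by (simp add: incident_def)
    then have "?p (fst (ends g), g) < k \<longleftrightarrow> ?p (opp g (fst (ends g)), g) < k"
      using that seg inc_opp[OF that(1) i] crosses_iff[OF that(1) i, of S] by (simp add: flags_iff)
    then show ?thesis by (rule eta_shift(1)[OF T s k that(1) i])
  qed
  have flip: "eta v e T g = x \<and> eta v ?e' T g = opp g x"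
    if "g \<in> E" "inc g x" "(x, g) = (v, e) \<or> x \<in> S" "\<not> ((opp g x, g) = (v, e) \<or> opp g x \<in> S)" for g x
    by (rule eta_shift(2)[OF T s k that(1,2)])
      (use that seg inc_opp[OF that(1,2)] in \<open>simp_all add: flags_iff\<close>)
  \<comment> \<open>If \<open>e\<close> is a tree edge, its Laplacian term cancels the correction,
    as \<open>e\<close> carries no chip. Otherwise \<open>S\<close> is empty and the correction is
    the chip of \<open>e\<close> moving from \<open>v\<close> to \<open>?w\<close>.\<close>
  have edge_term: "of_bool (g \<notin> T) * of_bool (eta v ?e' T g = u) =
      of_bool (g \<notin> T) * of_bool (eta v e T g = u) + d u g +
      of_bool (g = e) * (of_bool (?w = u) - of_bool (v = u))" if g: "g \<in> E" for g u
  proof (cases "g = e")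
    case True
    show ?thesis
    proof (cases "e \<in> T")
      case True
      then show ?thesis using \<open>g = e\<close> d[OF e, of u] S by (simp add: f_def)
    next
      case False
      then have "eta v e T e = v \<and> eta v ?e' T e = ?w"
        using flip[OF e] S opp_neq[OF e] by auto
      then show ?thesis using \<open>g = e\<close> d[OF e, of u] S False by (simp add: f_def)
    qed
  next
    case False
    show ?thesis
    proof (cases "crosses ends S g")
      case True
      then obtain x where x: "x \<in> S" "opp g x \<notin> S" "inc g x"
        using g no_loop by (auto simp: crosses_def incident_def other_end_def) metis+
      have "g \<notin> T" using nc[of g] True False by auto
      moreover have "eta v e T g = x \<and> eta v ?e' T g = opp g x"
        using flip[OF g x(3)] x False by simp
      ultimately show ?thesis using d[OF g x(3), of u] x False by (simp add: f_def)
    next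
      case nc': False
      have "d u g = 0" using nc' by (auto simp: d_def f_def crosses_def)
      then show ?thesis using shift[OF g False nc'] False by simp
    qed
  qed
  have "beta v ?e' T u - (beta v e T u + (chip ?w u - chip v u)) = laplacian E ends f u" for u
  proof -
    have "beta v ?e' T u = (\<Sum>g\<in>E. of_bool (g \<notin> T) * of_bool (eta v e T g = u) + d u g +
      of_bool (g = e) * (of_bool (?w = u) - of_bool (v = u)))"
      unfolding bernardi_eq_sum[OF tree_edges[OF T]] by (intro sum.cong refl edge_term)
    also have "\<dots> = beta v e T u + (\<Sum>g\<in>E. d u g) +
        (\<Sum>g\<in>E. of_bool (g = e)) * (of_bool (?w = u) - of_bool (v = u))"
      by (simp only: sum.distrib bernardi_eq_sum[OF tree_edges[OF T]] flip: sum_distrib_right)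
    also have "(\<Sum>g\<in>E. of_bool (g = e)) = (1 :: int)"
      using finite_E e by (simp add: of_bool_def)
    finally show ?thesis by (simp add: chip_def laplacian_edge_sum d_def)
  qed
  then show ?thesis unfolding lin_equiv_def by blast
qed

section \<open>Translating break divisors by divisors of degree 0\<close>

definition translates_breaks :: "'v divisor \<Rightarrow> bool" where
  "translates_breaks X \<longleftrightarrow> (\<forall>D\<in>break_divisors V E ends.
     \<exists>D'\<in>break_divisors V E ends. lin_equiv E ends D' (\<lambda>u. D u + X u))"

lemma translates_zero: "translates_breaks (\<lambda>_. 0)"
  unfolding translates_breaks_def using lin_equiv_refl by fastforce

lemma translates_add:
  assumes "translates_breaks X" "translates_breaks Y"
  shows "translates_breaks (\<lambda>u. X u + Y u)"
  unfolding translates_breaks_def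
proof
  fix D assume "D \<in> break_divisors V E ends"
  then obtain D' where D': "D' \<in> break_divisors V E ends" "lin_equiv E ends D' (\<lambda>u. D u + X u)"
    using assms(1) unfolding translates_breaks_def by blast
  then obtain D'' where D'': "D'' \<in> break_divisors V E ends" "lin_equiv E ends D'' (\<lambda>u. D' u + Y u)"
    using assms(2) unfolding translates_breaks_def by blast
  have "lin_equiv E ends D'' (\<lambda>u. D u + X u + Y u)"
    using lin_equiv_trans[OF D''(2) lin_equiv_add_cong[OF D'(2)]] .
  then show "\<exists>D'\<in>break_divisors V E ends. lin_equiv E ends D' (\<lambda>u. D u + (X u + Y u))"
    using D''(1) by (auto simp: add.assoc)
qed

text \<open>Moving a chip across an edge \<open>e\<close> at \<open>v\<close> is the effect of replacing \<open>e\<close> by the next edge as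
  the start of the tour.\<close>

lemma translates_edge:
  assumes "(v, e) \<in> flags"
  shows "translates_breaks (\<lambda>u. chip (opp e v) u - chip v u)"
  unfolding translates_breaks_def
proof
  fix D assume "D \<in> break_divisors V E ends"
  then obtain T where T: "T \<in> trees" "beta v e T = D" using bernardi_surj[OF assms] by blast
  have "beta v (rot v e) T \<in> break_divisors V E ends"
    by (rule bernardi_break[OF T(1) rot_flags[OF assms]])
  then show "\<exists>D'\<in>break_divisors V E ends.
      lin_equiv E ends D' (\<lambda>u. D u + (chip (opp e v) u - chip v u))"
    using bernardi_rot[OF T(1) assms] T(2) by blast
qed

lemma translates_path:
  assumes "x \<in> V" "y \<in> V"
  shows "translates_breaks (\<lambda>u. chip y u - chip x u)"
proof -
  have "(x, y) \<in> (adj_rel ends E)\<^sup>*" using connected_E assms by (auto simp: connected_on_def)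
  then show ?thesis
  proof (induction rule: rtrancl_induct)
    case base
    then show ?case using translates_zero by simp
  next
    case (step y z)
    obtain g where g: "g \<in> E" "(y, z) = ends g \<or> (z, y) = ends g"
      using step.hyps(2) by (auto simp: adj_rel_def)
    then have "inc g y" "opp g y = z"
      using no_loop[OF g(1)] unfolding incident_def other_end_def by (metis fst_conv snd_conv)+
    then have "translates_breaks (\<lambda>u. chip z u - chip y u)"
      using translates_edge[of y g] g(1) by (simp add: flags_iff)
    from translates_add[OF step.IH this] show ?case by (simp add: algebra_simps)
  qed
qed

lemma translates_multiple: "translates_breaks X \<Longrightarrow> translates_breaks (\<lambda>u. int n * X u)"
proof (induction n)
  case (Suc n)
  from translates_add[OF Suc.prems Suc.IH[OF Suc.prems]] show ?case by (simp add: algebra_simps)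
qed (simp add: translates_zero)

text \<open>\<open>X\<close> is the sum of the moves of \<open>X x\<close> chips from a fixed vertex
  \<open>q\<close> to \<open>x\<close>, the multiples of \<open>chip q\<close> cancelling by degree
  0; negative coefficients use the reverse moves.\<close>

lemma translates_degree_zero:
  assumes "is_divisor V X" "deg V X = 0"
  shows "translates_breaks X"
proof -
  obtain q where q: "q \<in> V" using V_nonempty by auto
  have single: "translates_breaks (\<lambda>u. X x * (chip x u - chip q u))" if "x \<in> V" for x
  proof (cases "X x \<ge> 0")
    case True
    then show ?thesis
      using translates_multiple[OF translates_path[OF q that], of "nat (X x)"] by simp
  next
    case False
    then show ?thesis
      using translates_multiple[OF translates_path[OF that q], of "nat (- X x)"]
      by (simp add: algebra_simps)
  qed
  have "finite A \<Longrightarrow> A \<subseteq> V \<Longrightarrow> translates_breaks (\<lambda>u. \<Sum>x\<in>A. X x * (chip x u - chip q u))" for A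
  proof (induction rule: finite_induct)
    case (insert x A)
    have "translates_breaks (\<lambda>u. X x * (chip x u - chip q u) +
        (\<Sum>x\<in>A. X x * (chip x u - chip q u)))"
      by (rule translates_add) (use insert single in auto)
    then show ?case using insert.hyps by simp
  qed (simp add: translates_zero)
  from this[OF finite_V subset_refl]
  have "translates_breaks (\<lambda>u. \<Sum>x\<in>V. X x * (chip x u - chip q u))" .
  moreover have "(\<Sum>x\<in>V. X x * (chip x u - chip q u)) = X u" for u
  proof -
    have "(\<Sum>x\<in>V. X x * (chip x u - chip q u)) = (\<Sum>x\<in>V. X x * chip x u) - deg V X * chip q u"
      by (simp add: right_diff_distrib sum_subtractf deg_def sum_distrib_right)
    also have "(\<Sum>x\<in>V. X x * chip x u) = (\<Sum>x\<in>V. if x = u then X x else 0)"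
      by (intro sum.cong refl) (simp add: chip_def)
    finally show ?thesis using assms finite_V by (auto simp: is_divisor_def)
  qed
  ultimately show ?thesis by simp
qed

section \<open>The action of the Picard group on break divisors and trees\<close>

lemma pic_act_eqI:
  assumes "\<gamma> \<in> Pic0 V E ends" "\<delta> \<in> \<gamma>" "B \<in> break_divisors V E ends"
    and eq: "lin_equiv E ends B (\<lambda>u. D u + \<delta> u)"
  shows "pic_act V E ends \<gamma> D = B"
  unfolding pic_act_def
proof (rule the_equality)
  show "B \<in> break_divisors V E ends \<and> (\<exists>\<delta>\<in>\<gamma>. lin_equiv E ends B (\<lambda>u. D u + \<delta> u))"
    using assms by blast
  fix B' assume B': "B' \<in> break_divisors V E ends \<and> (\<exists>\<delta>\<in>\<gamma>. lin_equiv E ends B' (\<lambda>u. D u + \<delta> u))"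
  then obtain \<delta>' where \<delta>': "\<delta>' \<in> \<gamma>" "lin_equiv E ends B' (\<lambda>u. D u + \<delta>' u)" by blast
  \<comment> \<open>All members of a class are equivalent, so another representative again gives a
    break divisor equivalent to \<open>B\<close>.\<close>
  have "lin_equiv E ends \<delta>' \<delta>"
    using assms(1,2) \<delta>'(1) lin_equiv_trans[OF lin_equiv_sym] by (auto simp: Pic0_def)
  then have "lin_equiv E ends B' B"
    using lin_equiv_trans[OF \<delta>'(2) lin_equiv_trans[OF lin_equiv_add_cong2 lin_equiv_sym[OF eq]]] by blast
  then show "B' = B" using B' assms(3) break_divisor_unique by blast
qed

lemma Pic0_obtain:
  assumes "\<gamma> \<in> Pic0 V E ends"
  obtains \<delta> where "\<delta> \<in> \<gamma>" "is_divisor V \<delta>" "deg V \<delta> = 0"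
  using assms lin_equiv_refl unfolding Pic0_def by blast

text \<open>The chip moves of successive rotations add up. \<open>X\<close> is chosen before
  \<open>T\<close>, which makes one class work for all trees.\<close>

lemma bernardi_rot_power:
  assumes "(v, e) \<in> flags"
  shows "\<exists>X. is_divisor V X \<and> deg V X = 0 \<and>
    (\<forall>T\<in>trees. lin_equiv E ends (beta v ((rot v ^^ n) e) T) (\<lambda>u. beta v e T u + X u))"
proof (induction n)
  case 0
  show ?case by (intro exI[of _ "\<lambda>_. 0"]) (simp add: is_divisor_def deg_def lin_equiv_refl)
next
  case (Suc n)
  then obtain X where X: "is_divisor V X" "deg V X = 0"
    "\<And>T. T \<in> trees \<Longrightarrow> lin_equiv E ends (beta v ((rot v ^^ n) e) T) (\<lambda>u. beta v e T u + X u)"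
    by blast
  let ?e = "(rot v ^^ n) e"
  have fl: "(v, ?e) \<in> flags" using assms by (induction n) (auto simp: rot_flags)
  let ?w = "opp ?e v"
  define Y where "Y u = X u + (chip ?w u - chip v u)" for u
  have v: "v \<in> V" "?w \<in> V" using fl inc_V inc_opp by (auto simp: flags_iff)
  have "is_divisor V Y" using X(1) v by (auto simp: is_divisor_def Y_def chip_def)
  moreover have "(\<Sum>u\<in>V. chip x u) = 1" if "x \<in> V" for x
    using that finite_V by (simp add: chip_def of_bool_def)
  then have "deg V Y = 0" using X(2) v by (simp add: deg_def Y_def sum.distrib sum_subtractf)
  moreover have "lin_equiv E ends (beta v ((rot v ^^ Suc n) e) T) (\<lambda>u. beta v e T u + Y u)"
    if "T \<in> trees" for T
    using lin_equiv_trans[OF bernardi_rot[OF that fl] lin_equiv_add_cong[OF X(3)[OF that]]]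
    by (simp add: Y_def add.assoc)
  ultimately show ?case by blast
qed

lemma bernardi_translate:
  assumes "(v, e1) \<in> flags" "(v, e2) \<in> flags"
  shows "\<exists>X. is_divisor V X \<and> deg V X = 0 \<and>
    (\<forall>T\<in>trees. lin_equiv E ends (beta v e2 T) (\<lambda>u. beta v e1 T u + X u))"
  using rot_transitive[OF assms] bernardi_rot_power[OF assms(1)] by metis

lemma pic_act_translates:
  assumes s: "(v, e1) \<in> flags" "(v, e2) \<in> flags"
  shows "\<exists>\<gamma>0\<in>Pic0 V E ends. \<forall>T\<in>trees. beta v e2 T = pic_act V E ends \<gamma>0 (beta v e1 T)"
proof -
  obtain X where X: "is_divisor V X" "deg V X = 0"
    "\<And>T. T \<in> trees \<Longrightarrow> lin_equiv E ends (beta v e2 T) (\<lambda>u. beta v e1 T u + X u)"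
    using bernardi_translate[OF s] by blast
  define \<gamma> where "\<gamma> = {D'. is_divisor V D' \<and> lin_equiv E ends X D'}"
  have \<gamma>: "\<gamma> \<in> Pic0 V E ends" "X \<in> \<gamma>" using X lin_equiv_refl by (auto simp: Pic0_def \<gamma>_def)
  then show ?thesis
    using pic_act_eqI[OF \<gamma> bernardi_break[OF _ s(2)] X(3)] by metis
qed

text \<open>Passing from \<open>e1\<close> to \<open>e2\<close> translates the Bernardi divisors of
  all trees by the same \<open>X\<close>, and this commutes with translation by \<delta>.\<close>

lemma tree_act_independent:
  assumes s: "(v, e1) \<in> flags" "(v, e2) \<in> flags"
    and \<gamma>: "\<gamma> \<in> Pic0 V E ends" and T: "T \<in> trees"
  shows "tree_act V E ends rot v e1 \<gamma> T = tree_act V E ends rot v e2 \<gamma> T"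
proof -
  obtain \<delta> where \<delta>: "\<delta> \<in> \<gamma>" "is_divisor V \<delta>" "deg V \<delta> = 0" using \<gamma> by (rule Pic0_obtain)
  obtain X where X: "\<And>T. T \<in> trees \<Longrightarrow> lin_equiv E ends (beta v e2 T) (\<lambda>u. beta v e1 T u + X u)"
    using bernardi_translate[OF s] by blast
  obtain B where B: "B \<in> break_divisors V E ends" "lin_equiv E ends B (\<lambda>u. beta v e1 T u + \<delta> u)"
    using translates_degree_zero[OF \<delta>(2,3)] bernardi_break[OF T s(1)]
    unfolding translates_breaks_def by blast
  \<comment> \<open>The common value of both actions.\<close>
  obtain T' where T': "T' \<in> trees" "beta v e1 T' = B" using bernardi_surj[OF s(1) B(1)] by blast
  have "lin_equiv E ends (beta v e2 T') (\<lambda>u. beta v e1 T u + \<delta> u + X u)"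
    using lin_equiv_trans[OF X[OF T'(1)]] lin_equiv_add_cong[OF B(2), of X] T'(2) by simp
  also have "(\<lambda>u. beta v e1 T u + \<delta> u + X u) = (\<lambda>u. beta v e1 T u + X u + \<delta> u)"
    by (simp add: algebra_simps)
  finally have "lin_equiv E ends (beta v e2 T') (\<lambda>u. beta v e2 T u + \<delta> u)"
    using lin_equiv_trans lin_equiv_add_cong[OF lin_equiv_sym[OF X[OF T]]] by blast
  then have 2: "pic_act V E ends \<gamma> (beta v e2 T) = beta v e2 T'"
    by (rule pic_act_eqI[OF \<gamma> \<delta>(1) bernardi_break[OF T'(1) s(2)]])
  have 1: "pic_act V E ends \<gamma> (beta v e1 T) = beta v e1 T'"
    using pic_act_eqI[OF \<gamma> \<delta>(1) B] T'(2) by simp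
  show ?thesis
    unfolding tree_act_def 1 2
    using inv_into_f_f[OF bernardi_inj[OF s(1)] T'(1)] inv_into_f_f[OF bernardi_inj[OF s(2)] T'(1)]
    by simp
qed

end

theorem theorem4p1:
  fixes V :: "'v set" and E :: "'e set" and ends :: "'e \<Rightarrow> 'v \<times> 'v"
    and rot :: "'v \<Rightarrow> 'e \<Rightarrow> 'e" and v :: 'v and e1 e2 :: 'e
  assumes "ribbon_graph V E ends rot"
    and "v \<in> V"
    and "e1 \<in> inc_edges E ends v"
    and "e2 \<in> inc_edges E ends v"
  shows "(\<exists>\<gamma>0\<in>Pic0 V E ends. \<forall>T\<in>spanning_trees V E ends.
            bernardi E ends rot v e2 T = pic_act V E ends \<gamma>0 (bernardi E ends rot v e1 T))
       \<and> (\<forall>\<gamma>\<in>Pic0 V E ends. \<forall>T\<in>spanning_trees V E ends.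
            tree_act V E ends rot v e1 \<gamma> T = tree_act V E ends rot v e2 \<gamma> T)"
proof -
  interpret ribbon V E ends rot by unfold_locales (rule assms(1))
  have "(v, e1) \<in> flags" "(v, e2) \<in> flags" using assms(2-4) by (auto simp: flags_inc_edges)
  then show ?thesis using pic_act_translates tree_act_independent by blast
qed

end
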